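(* Let $\widetilde K(t,u;k)$ be the function defined in the context and let $k_0\ge2$ be an integer such that $\widetilde K(t-\frac12,u-\frac12;k)>0$ for all $(t,u)\in[0,1]^2$ and all $k\ge k_0$ (such $k_0$ exists). Let $\beta>0$. Then for every integer $k\ge k_0$ the model with Hamiltonian $$H(\sigma)=-\frac1\beta\sum_{\langle x,y\rangle}\ln\widetilde K\left(\sigma(x)-\tfrac12,\sigma(y)-\tfrac12;k\right)$$ on the Cayley tree $\Gamma^k$ of order $k$, where each edge $\langle x,y\rangle$ is written so that $y$ is a direct successor of $x$, has at least four periodic Gibbs measures (of period two).
   Context: For integers $n,m\ge1$, $p\ge0$ let $A_n^{(m,p)}$ be the $n\times n$ matrix with $(i,j)$ entry $\dfrac{1}{4^{p+i+j-2}\,(m+2(i-1)+2(j-1))}$, $1\le i,j\le n$ (invertible for the matrices used below). Put $$(a_{11},a_{12},a_{13})^T=(A_3^{(1,0)})^{-1}(0,\tfrac16,0)^T,\quad (a_{21},a_{22},a_{23})^T=(A_3^{(3,1)})^{-1}(0,0,\tfrac1{20})^T,$$ $$(b_{11},b_{12})^T=(A_2^{(5,2)})^{-1}(0,1)^T,\quad (b_{21},b_{22})^T=(A_2^{(7,3)})^{-1}(1,0)^T,$$ $$\psi_1(u)=a_{11}+a_{12}u^2+a_{13}u^4,\quad \psi_2(u)=a_{21}u^2+a_{22}u^4+a_{23}u^6,\quad \psi_3(u)=b_{11}u+b_{12}u^3,\quad \psi_4(u)=b_{21}u^3+b_{22}u^5,$$ and for $t,u\in[-\frac12,\frac12]$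 $$\widetilde K(t,u;k)=1+\psi_1(u)\left(\sqrt[k]{20t^4+\tfrac34}-1\right)+\psi_2(u)\left(\sqrt[k]{6t^2+\tfrac12}-1\right)+\psi_3(u)\left(\sqrt[k]{t^3+1}-1\right)+\psi_4(u)\left(\sqrt[k]{t^5+1}-1\right).$$ The Cayley tree $\Gamma^k=(V,L)$ of order $k$ is the infinite tree in which every vertex has exactly $k+1$ incident edges. Fix a root $x^0$; $d$ is graph distance, $W_n=\{x: d(x,x^0)=n\}$, $V_n=\{x:d(x,x^0)\le n\}$. A neighbour $y$ of $x$ is a direct successor of $x$ if $d(y,x^0)=d(x,x^0)+1$. A vertex $x$ is even (odd) if $d(x,x^0)$ is even (odd). Configurations are functions $\sigma:V\to[0,1]$; $\lambda$ is Lebesgue measure on $[0,1]$, and $\lambda_A$ is the product measure on $\Omega_A=[0,1]^A$ for finite $A\subset V$. $H(\sigma_n)$, for $\sigma_n\in\Omega_{V_n}$, is the sum defining $H$ restricted to edges with both endpoints in $V_n$. Given functions $h_x=(h_{t,x})_{t\in[0,1]}$ for $x\in V\setminus\{x^0\}$, define for $n\ge1$ the probability densities with respect to $\lambda_{V_n}$ $$\mu^{(n)}(\sigma_n)=Z_n^{-1}\exp\Big(-\beta H(\sigma_n)+\sum_{x\in W_n}h_{\sigma_n(x),x}\Big),$$ with $Z_n$ the normalizing constant. They are compatible if $\int_{\Omega_{W_n}}\mu^{(n)}(\sigma_{n-1}\vee\omega_n)\,\lambda_{W_n}(d\omega_n)=\mu^{(n-1)}(\sigma_{n-1})$ for all $n\ge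 2$ and $\sigma_{n-1}\in\Omega_{V_{n-1}}$, where $\vee$ denotes concatenation. In that case the unique probability measure $\mu$ on $[0,1]^V$ whose restriction to each $V_n$ has density $\mu^{(n)}$ is called the splitting Gibbs measure corresponding to $H$ and $h$. A periodic Gibbs measure (of period two) is a splitting Gibbs measure corresponding to some $h$ for which there are positive continuous functions $f\ne g$ on $[0,1]$ with $\exp(h_{t,x}-h_{0,x})=f(t)$ for all even $x\neq x^0$ and $=g(t)$ for all odd $x$, $t\in[0,1]$. *)

theory Defs
  imports "HOL-Probability.Probability" "Jordan_Normal_Form.Gauss_Jordan_Elimination"
begin

unbundle no vec_syntax

section \<open>The kernel\<close>

text \<open>Rows and columns are counted from 0 here, so the exponent \<open>p + i + j - 2\<close> and the shifts
  \<open>i - 1\<close>, \<open>j - 1\<close> of the 1-based formula become \<open>p + i + j\<close>, \<open>i\<close> and \<open>j\<close>.\<close>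

definition A_mat :: "nat \<Rightarrow> nat \<Rightarrow> nat \<Rightarrow> real mat" where
  "A_mat n m p = Matrix.mat n n (\<lambda>(i, j). 1 / (4 ^ (p + i + j) * real (m + 2 * i + 2 * j)))"

definition a1 :: "real vec" where
  "a1 = the (mat_inverse (A_mat 3 1 0)) *\<^sub>v vec_of_list [0, 1/6, 0]"

definition a2 :: "real vec" where
  "a2 = the (mat_inverse (A_mat 3 3 1)) *\<^sub>v vec_of_list [0, 0, 1/20]"

definition b1 :: "real vec" where
  "b1 = the (mat_inverse (A_mat 2 5 2)) *\<^sub>v vec_of_list [0, 1]"

definition b2 :: "real vec" where
  "b2 = the (mat_inverse (A_mat 2 7 3)) *\<^sub>v vec_of_list [1, 0]"

definition psi1 :: "real \<Rightarrow> real" where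
  "psi1 u = a1 $ 0 + a1 $ 1 * u ^ 2 + a1 $ 2 * u ^ 4"

definition psi2 :: "real \<Rightarrow> real" where
  "psi2 u = a2 $ 0 * u ^ 2 + a2 $ 1 * u ^ 4 + a2 $ 2 * u ^ 6"

definition psi3 :: "real \<Rightarrow> real" where
  "psi3 u = b1 $ 0 * u + b1 $ 1 * u ^ 3"

definition psi4 :: "real \<Rightarrow> real" where
  "psi4 u = b2 $ 0 * u ^ 3 + b2 $ 1 * u ^ 5"

definition K_tilde :: "real \<Rightarrow> real \<Rightarrow> nat \<Rightarrow> real" where
  "K_tilde t u k = 1
     + psi1 u * (root k (20 * t ^ 4 + 3/4) - 1)
     + psi2 u * (root k (6 * t ^ 2 + 1/2) - 1)
     + psi3 u * (root k (t ^ 3 + 1) - 1)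
     + psi4 u * (root k (t ^ 5 + 1) - 1)"

definition K_tilde_positive_from :: "nat \<Rightarrow> bool" where
  "K_tilde_positive_from k0 \<longleftrightarrow>
     (\<forall>k\<ge>k0. \<forall>t\<in>{0..1}. \<forall>u\<in>{0..1}. K_tilde (t - 1/2) (u - 1/2) k > 0)"


section \<open>Cayley trees\<close>

text \<open>An edge is the two-element set of its endpoints.\<close>

definition adjacency :: "'v set set \<Rightarrow> ('v \<times> 'v) set" where
  "adjacency L = {(x, y). {x, y} \<in> L}"

definition simple_graph :: "'v set \<Rightarrow> 'v set set \<Rightarrow> bool" where
  "simple_graph V L \<longleftrightarrow> L \<subseteq> {{x, y} | x y. x \<in> V \<and> y \<in> V \<and> x \<noteq> y}"

definition graph_cycle :: "'v set set \<Rightarrow> 'v list \<Rightarrow> bool" where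
  "graph_cycle L p \<longleftrightarrow> length p \<ge> 3 \<and> distinct p \<and>
     successively (\<lambda>x y. {x, y} \<in> L) p \<and> {last p, hd p} \<in> L"

definition is_tree :: "'v set \<Rightarrow> 'v set set \<Rightarrow> bool" where
  "is_tree V L \<longleftrightarrow> simple_graph V L \<and> V \<noteq> {} \<and>
     (\<forall>x\<in>V. \<forall>y\<in>V. (x, y) \<in> (adjacency L)\<^sup>*) \<and> (\<nexists>p. graph_cycle L p)"

definition cayley_tree :: "nat \<Rightarrow> 'v set \<Rightarrow> 'v set set \<Rightarrow> bool" where
  "cayley_tree k V L \<longleftrightarrow> is_tree V L \<and> infinite V \<and> (\<forall>x\<in>V. card {e \<in> L. x \<in> e} = k + 1)"

definition graph_dist :: "'v set set \<Rightarrow> 'v \<Rightarrow> 'v \<Rightarrow> nat" where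
  "graph_dist L x y = (LEAST n. (x, y) \<in> adjacency L ^^ n)"

definition sphere_W :: "'v set \<Rightarrow> 'v set set \<Rightarrow> 'v \<Rightarrow> nat \<Rightarrow> 'v set" where
  "sphere_W V L x0 n = {x \<in> V. graph_dist L x x0 = n}"

definition ball_V :: "'v set \<Rightarrow> 'v set set \<Rightarrow> 'v \<Rightarrow> nat \<Rightarrow> 'v set" where
  "ball_V V L x0 n = {x \<in> V. graph_dist L x x0 \<le> n}"

definition direct_successor :: "'v set set \<Rightarrow> 'v \<Rightarrow> 'v \<Rightarrow> 'v \<Rightarrow> bool" where
  "direct_successor L x0 x y \<longleftrightarrow> {x, y} \<in> L \<and> graph_dist L y x0 = graph_dist L x x0 + 1"


section \<open>Splitting and periodic Gibbs measures\<close>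

text \<open>Configurations on \<open>A\<close> are the extensional functions \<open>A \<rightarrow>\<^sub>E {0..1}\<close>, and all measures live on the
  product of the Borel sigma-algebras of \<open>[0,1]\<close>.\<close>

definition unit_lebesgue :: "real measure" where
  "unit_lebesgue = restrict_space lborel {0..1}"

definition lambda_prod :: "'v set \<Rightarrow> ('v \<Rightarrow> real) measure" where
  "lambda_prod A = PiM A (\<lambda>_. unit_lebesgue)"

text \<open>The formal Hamiltonian on the infinite tree enters only through its restrictions \<open>H A \<sigma>\<close>, the sum
  over the edges with both endpoints in the finite set \<open>A\<close>.\<close>

type_synonym 'v hamiltonian = "'v set \<Rightarrow> ('v \<Rightarrow> real) \<Rightarrow> real"

text \<open>Every edge of a tree occurs exactly once as a pair \<open>(x, y)\<close> with \<open>y\<close> a direct successor of \<open>x\<close>.\<close>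

definition K_tilde_hamiltonian :: "'v set set \<Rightarrow> 'v \<Rightarrow> real \<Rightarrow> nat \<Rightarrow> 'v hamiltonian" where
  "K_tilde_hamiltonian L x0 \<beta> k A \<sigma> =
     - (1 / \<beta>) * (\<Sum>(x, y) \<in> {(x, y). x \<in> A \<and> y \<in> A \<and> direct_successor L x0 x y}.
                     ln (K_tilde (\<sigma> x - 1/2) (\<sigma> y - 1/2) k))"

text \<open>A boundary field is written \<open>h x t\<close> for \<open>h\<^bsub>t,x\<^esub>\<close>. Its value at the root is never used, since
  only the levels \<open>n \<ge> 1\<close> are considered.\<close>

definition gibbs_weight ::
  "'v set \<Rightarrow> 'v set set \<Rightarrow> 'v \<Rightarrow> real \<Rightarrow> 'v hamiltonian \<Rightarrow> ('v \<Rightarrow> real \<Rightarrow> real) \<Rightarrow> nat \<Rightarrow> ('v \<Rightarrow> real) \<Rightarrow> real" where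
  "gibbs_weight V L x0 \<beta> H h n \<sigma> =
     exp (- \<beta> * H (ball_V V L x0 n) \<sigma> + (\<Sum>x \<in> sphere_W V L x0 n. h x (\<sigma> x)))"

definition gibbs_Z ::
  "'v set \<Rightarrow> 'v set set \<Rightarrow> 'v \<Rightarrow> real \<Rightarrow> 'v hamiltonian \<Rightarrow> ('v \<Rightarrow> real \<Rightarrow> real) \<Rightarrow> nat \<Rightarrow> real" where
  "gibbs_Z V L x0 \<beta> H h n = (LINT \<sigma>|lambda_prod (ball_V V L x0 n). gibbs_weight V L x0 \<beta> H h n \<sigma>)"

definition gibbs_density ::
  "'v set \<Rightarrow> 'v set set \<Rightarrow> 'v \<Rightarrow> real \<Rightarrow> 'v hamiltonian \<Rightarrow> ('v \<Rightarrow> real \<Rightarrow> real) \<Rightarrow> nat \<Rightarrow> ('v \<Rightarrow> real) \<Rightarrow> real" where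
  "gibbs_density V L x0 \<beta> H h n \<sigma> = inverse (gibbs_Z V L x0 \<beta> H h n) * gibbs_weight V L x0 \<beta> H h n \<sigma>"

text \<open>Integrability says that the normalizing constants exist, i.e. that the densities are well
  defined; the Bochner integral would otherwise default to 0.\<close>

definition compatible_densities ::
  "'v set \<Rightarrow> 'v set set \<Rightarrow> 'v \<Rightarrow> real \<Rightarrow> 'v hamiltonian \<Rightarrow> ('v \<Rightarrow> real \<Rightarrow> real) \<Rightarrow> bool" where
  "compatible_densities V L x0 \<beta> H h \<longleftrightarrow>
     (\<forall>n\<ge>1. integrable (lambda_prod (ball_V V L x0 n)) (gibbs_weight V L x0 \<beta> H h n)) \<and>
     (\<forall>n\<ge>2. \<forall>\<sigma> \<in> ball_V V L x0 (n - 1) \<rightarrow>\<^sub>E {0..1}.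
        (LINT \<omega>|lambda_prod (sphere_W V L x0 n).
           gibbs_density V L x0 \<beta> H h n (merge (ball_V V L x0 (n - 1)) (sphere_W V L x0 n) (\<sigma>, \<omega>)))
        = gibbs_density V L x0 \<beta> H h (n - 1) \<sigma>)"

definition splitting_gibbs_measure ::
  "'v set \<Rightarrow> 'v set set \<Rightarrow> 'v \<Rightarrow> real \<Rightarrow> 'v hamiltonian \<Rightarrow> ('v \<Rightarrow> real \<Rightarrow> real) \<Rightarrow> ('v \<Rightarrow> real) measure \<Rightarrow> bool" where
  "splitting_gibbs_measure V L x0 \<beta> H h \<mu> \<longleftrightarrow>
     compatible_densities V L x0 \<beta> H h \<and>
     prob_space \<mu> \<and> sets \<mu> = sets (PiM V (\<lambda>_. unit_lebesgue)) \<and>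
     (\<forall>n\<ge>1. distr \<mu> (lambda_prod (ball_V V L x0 n)) (\<lambda>\<sigma>. restrict \<sigma> (ball_V V L x0 n))
            = density (lambda_prod (ball_V V L x0 n)) (\<lambda>\<sigma>. ennreal (gibbs_density V L x0 \<beta> H h n \<sigma>)))"

definition periodic_gibbs_measure ::
  "'v set \<Rightarrow> 'v set set \<Rightarrow> 'v \<Rightarrow> real \<Rightarrow> 'v hamiltonian \<Rightarrow> ('v \<Rightarrow> real) measure \<Rightarrow> bool" where
  "periodic_gibbs_measure V L x0 \<beta> H \<mu> \<longleftrightarrow>
     (\<exists>h f g. splitting_gibbs_measure V L x0 \<beta> H h \<mu> \<and>
        continuous_on {0..1} f \<and> continuous_on {0..1} g \<and>
        (\<forall>t\<in>{0..1}. f t > 0) \<and> (\<forall>t\<in>{0..1}. g t > 0) \<and>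
        (\<exists>t\<in>{0..1::real}. f t \<noteq> (g t :: real)) \<and>
        (\<forall>x\<in>V. x \<noteq> x0 \<longrightarrow> even (graph_dist L x x0) \<longrightarrow> (\<forall>t\<in>{0..1}. exp (h x t - h x 0) = f t)) \<and>
        (\<forall>x\<in>V. odd (graph_dist L x x0) \<longrightarrow> (\<forall>t\<in>{0..1}. exp (h x t - h x 0) = g t)))"

end

theory Submission
  imports Defs "Jordan_Normal_Form.Determinant"
begin

text \<open>
  If positive functions \<open>f\<close>, \<open>g\<close> satisfy \<open>\<integral> K(t,u) g(u) du = f(t)\<^bsup>1/k\<^esup>\<close> and
  \<open>\<integral> K(t,u) f(u) du = g(t)\<^bsup>1/k\<^esup>\<close>, then the boundary field \<open>ln f\<close> on even and \<open>ln g\<close> on odd vertices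
  is compatible: integrating out the \<open>k\<close> children of \<open>x\<close> multiplies \<open>k\<close> factors \<open>f(\<sigma>(x))\<^bsup>1/k\<^esup>\<close>
  (or \<open>g\<close>), which restores the weight of \<open>x\<close>. The linear systems defining the \<open>\<psi>\<^sub>i\<close> are moment
  conditions on \<open>[-1/2, 1/2]\<close>. They say that the kernel interchanges the four functions under the
  roots: \<open>20 u\<^sup>4 + 3/4\<close> with \<open>6 u\<^sup>2 + 1/2\<close>, and \<open>u\<^sup>3 + 1\<close> with \<open>u\<^sup>5 + 1\<close>. Each interchanged pair can be
  used in two orders, which gives four measures. They are distinct because the law of the spin at
  the root has density proportional to \<open>f\<^bsup>(k+1)/k\<^esup>\<close>, and no two of the four functions are proportional.
\<close>

section \<open>Moments of the kernel\<close>

text \<open>The constants come from one cancellation. On [-1/2, 1/2] each \<psi>_i sees a single one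
  of the monomials 1, u^2, u^3, u^4, u^5: \<psi>_1 pairs with u^2 to 1/6, \<psi>_2 with u^4 to 1/20,
  \<psi>_3 with u^5 to 1 and \<psi>_4 with u^3 to 1; all other pairings vanish, by a moment equation
  or by parity. The summands 3/4 and 1/2 give the even radicands integral 1, which the odd ones have
  anyway. So the kernel sends a radicand to 1 plus one surviving term of the form root minus 1.

  The root of the tree is the exception to the level-by-level recursion: it has k + 1 children, so
  weights are restored only at levels n >= 1, and every induction over levels starts there. What is
  left at the root is a one-dimensional density whose mass normalises all levels n >= 1. The
  analysis is done with nonnegative integrals of product weights; logarithms enter only when these
  are matched with \<open>H\<close> and \<open>h\<close>.\<close>

lemma mat_inverse_mult_vec:
  fixes A :: "'a::field mat"
  assumes A: "A \<in> carrier_mat n n" and B: "B \<in> carrier_mat n n" and AB: "A * B = 1\<^sub>m n"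
    and v: "v \<in> carrier_vec n"
  shows "A *\<^sub>v (the (mat_inverse A) *\<^sub>v v) = v" "the (mat_inverse A) *\<^sub>v v \<in> carrier_vec n"
proof -
  \<comment> \<open>\<open>mat_inverse\<close> returns an option, so \<open>the\<close> has meaning
    only for invertible \<open>A\<close>. A one-sided inverse is enough: for square matrices over a
    field it is two-sided, and a unit excludes \<open>None\<close>.\<close>
  have "B * A = 1\<^sub>m n"
    using mat_mult_left_right_inverse[OF A B AB] .
  then have "A \<in> Units (ring_mat TYPE('a) n ())"
    using A B AB by (auto simp: Units_def ring_mat_def)
  then have "mat_inverse A \<noteq> None"
    using mat_inverse(1)[OF A, where b = "()"] by blast
  then obtain C where C: "mat_inverse A = Some C"
    by auto
  have C': "A * C = 1\<^sub>m n" "C \<in> carrier_mat n n"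
    using mat_inverse(2)[OF A C] by auto
  show "the (mat_inverse A) *\<^sub>v v \<in> carrier_vec n"
    using C C' v by simp
  have "A *\<^sub>v (C *\<^sub>v v) = (A * C) *\<^sub>v v"
    using assoc_mult_mat_vec[OF A C'(2) v] by simp
  then show "A *\<^sub>v (the (mat_inverse A) *\<^sub>v v) = v"
    using C C' v by simp
qed

text \<open>Row i of the linear system solved by the coefficient vector. In all four uses m = 2p +
  1, so the matrix entry is the integral of u^(2(p+i+j)) over [-1/2, 1/2] and the row is a moment
  condition. \<open>B\<close> only certifies invertibility.\<close>

lemma A_mat_mult_inverse:
  assumes "A_mat n m p * B = 1\<^sub>m n" "B \<in> carrier_mat n n" "v \<in> carrier_vec n" "i < n"
  shows "(\<Sum>j<n. (the (mat_inverse (A_mat n m p)) *\<^sub>v v) $ j / (4 ^ (p + i + j) * real (m + 2 * i + 2 * j))) = v $ i"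
proof -
  have A: "A_mat n m p \<in> carrier_mat n n"
    by (simp add: A_mat_def)
  define w where "w = the (mat_inverse (A_mat n m p)) *\<^sub>v v"
  note w = mat_inverse_mult_vec[OF A assms(2,1,3), folded w_def]
  have "v $ i = (A_mat n m p *\<^sub>v w) $ i"
    using w by simp
  also have "\<dots> = (\<Sum>j<n. w $ j / (4 ^ (p + i + j) * real (m + 2 * i + 2 * j)))"
    using w(2) \<open>i < n\<close> by (simp add: A_mat_def scalar_prod_def atLeast0LessThan)
  finally show ?thesis
    by (simp add: w_def)
qed

section \<open>Certificates of invertibility and the resulting moment equations\<close>

lemma A_mat_3_1_0_inverse:
  "A_mat 3 1 0 * mat_of_rows_list 3 [[225/64, -525/8, 945/4], [-525/8, 2205, -9450], [945/4, -9450, 44100]] = 1\<^sub>m 3"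
  by (rule eq_matI)
    (auto simp: A_mat_def scalar_prod_def mat_of_rows_list_def numeral_3_eq_3 less_Suc_eq)

lemma A_mat_3_3_1_inverse:
  "A_mat 3 3 1 * mat_of_rows_list 3 [[3675/16, -6615/2, 10395], [-6615/2, 56700, -194040], [10395, -194040, 698544]] = 1\<^sub>m 3"
  by (rule eq_matI)
    (auto simp: A_mat_def scalar_prod_def mat_of_rows_list_def numeral_3_eq_3 less_Suc_eq)

lemma A_mat_2_5_2_inverse:
  "A_mat 2 5 2 * mat_of_rows_list 2 [[980, -5040], [-5040, 28224]] = 1\<^sub>m 2"
  by (rule eq_matI)
    (auto simp: A_mat_def scalar_prod_def mat_of_rows_list_def less_2_cases_iff)

lemma A_mat_2_7_3_inverse:
  "A_mat 2 7 3 * mat_of_rows_list 2 [[9072, -44352], [-44352, 228096]] = 1\<^sub>m 2"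
  by (rule eq_matI)
    (auto simp: A_mat_def scalar_prod_def mat_of_rows_list_def less_2_cases_iff)

text \<open>The denominators 12, 80, 448, 2304 are 2^n (n + 1) for n = 2, 4, 6, 8, the reciprocals
  of the even moments. The equations say that \<psi>_1 is orthogonal to 1 and u^4 and pairs with u^2
  to 1/6.\<close>

lemma a1_moments:
  "a1 $ 0 + a1 $ 1 / 12 + a1 $ 2 / 80 = 0"
  "a1 $ 0 / 12 + a1 $ 1 / 80 + a1 $ 2 / 448 = 1/6"
  "a1 $ 0 / 80 + a1 $ 1 / 448 + a1 $ 2 / 2304 = 0"
proof -
  note * = A_mat_mult_inverse[OF A_mat_3_1_0_inverse, of "vec_of_list [0, 1/6, 0]", folded a1_def]
  show "a1 $ 0 + a1 $ 1 / 12 + a1 $ 2 / 80 = 0"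
    using *[of 0] by (simp add: mat_of_rows_list_def eval_nat_numeral)
  show "a1 $ 0 / 12 + a1 $ 1 / 80 + a1 $ 2 / 448 = 1/6"
    using *[of 1] by (simp add: mat_of_rows_list_def eval_nat_numeral)
  show "a1 $ 0 / 80 + a1 $ 1 / 448 + a1 $ 2 / 2304 = 0"
    using *[of 2] by (simp add: mat_of_rows_list_def eval_nat_numeral)
qed

text \<open>\<psi>_2 starts with u^2, hence the shifted moments: it is orthogonal to 1 and u^2 and
  pairs with u^4 to 1/20.\<close>

lemma a2_moments:
  "a2 $ 0 / 12 + a2 $ 1 / 80 + a2 $ 2 / 448 = 0"
  "a2 $ 0 / 80 + a2 $ 1 / 448 + a2 $ 2 / 2304 = 0"
  "a2 $ 0 / 448 + a2 $ 1 / 2304 + a2 $ 2 / 11264 = 1/20"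
proof -
  note * = A_mat_mult_inverse[OF A_mat_3_3_1_inverse, of "vec_of_list [0, 0, 1/20]", folded a2_def]
  show "a2 $ 0 / 12 + a2 $ 1 / 80 + a2 $ 2 / 448 = 0"
    using *[of 0] by (simp add: mat_of_rows_list_def eval_nat_numeral)
  show "a2 $ 0 / 80 + a2 $ 1 / 448 + a2 $ 2 / 2304 = 0"
    using *[of 1] by (simp add: mat_of_rows_list_def eval_nat_numeral)
  show "a2 $ 0 / 448 + a2 $ 1 / 2304 + a2 $ 2 / 11264 = 1/20"
    using *[of 2] by (simp add: mat_of_rows_list_def eval_nat_numeral)
qed

text \<open>Even powers are orthogonal to the odd \<psi>_3 by parity, so two equations suffice:
  orthogonality to u^3 and pairing 1 with u^5. For \<psi>_4 the two roles are exchanged.\<close>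

lemma b1_moments:
  "b1 $ 0 / 80 + b1 $ 1 / 448 = 0"
  "b1 $ 0 / 448 + b1 $ 1 / 2304 = 1"
proof -
  note * = A_mat_mult_inverse[OF A_mat_2_5_2_inverse, of "vec_of_list [0, 1]", folded b1_def]
  show "b1 $ 0 / 80 + b1 $ 1 / 448 = 0"
    using *[of 0] by (simp add: mat_of_rows_list_def eval_nat_numeral)
  show "b1 $ 0 / 448 + b1 $ 1 / 2304 = 1"
    using *[of 1] by (simp add: mat_of_rows_list_def eval_nat_numeral)
qed

lemma b2_moments:
  "b2 $ 0 / 448 + b2 $ 1 / 2304 = 1"
  "b2 $ 0 / 2304 + b2 $ 1 / 11264 = 0"
proof -
  note * = A_mat_mult_inverse[OF A_mat_2_7_3_inverse, of "vec_of_list [1, 0]", folded b2_def]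
  show "b2 $ 0 / 448 + b2 $ 1 / 2304 = 1"
    using *[of 0] by (simp add: mat_of_rows_list_def eval_nat_numeral)
  show "b2 $ 0 / 2304 + b2 $ 1 / 11264 = 0"
    using *[of 1] by (simp add: mat_of_rows_list_def eval_nat_numeral)
qed

section \<open>Integrals of polynomials in u - 1/2 against the kernel\<close>

definition center_moment :: "nat \<Rightarrow> real" where
  "center_moment n = (if even n then 1 / (2 ^ n * (n + 1)) else 0)"

lemma has_integral_center_moment:
  "((\<lambda>u::real. (u - 1/2) ^ n) has_integral center_moment n) {0..1}"
proof -
  have "((\<lambda>x. (x - 1/2) ^ Suc n / real (Suc n)) has_real_derivative (u - 1/2) ^ n) (at u within {0..1})" for u :: real
    by (auto intro!: derivative_eq_intros simp del: power_Suc of_nat_Suc)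
  then have "((\<lambda>u::real. (u - 1/2) ^ n) has_integral (1 - 1/2) ^ Suc n / real (Suc n) - (0 - 1/2) ^ Suc n / real (Suc n)) {0..1}"
    by (intro fundamental_theorem_of_calculus) (auto simp flip: has_real_derivative_iff_has_vector_derivative)
  also have "(1 - 1/2) ^ Suc n / real (Suc n) - (0 - 1/2) ^ Suc n / real (Suc n) = center_moment n"
  proof -
    define c N where "c = (1 / 2 ^ n :: real)" and "N = real (Suc n)"
    have "N > 0"
      by (simp add: N_def)
    have "(0 - 1/2 :: real) ^ Suc n = (if even n then - c / 2 else c / 2)" "(1 - 1/2 :: real) ^ Suc n = c / 2"
      using power_minus_even[of n "1/2 :: real"] power_minus_odd[of n "1/2 :: real"]
      by (auto simp: c_def power_one_over)
    moreover have "center_moment n = (if even n then c / N else 0)"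
      by (simp add: center_moment_def c_def N_def)
    ultimately show ?thesis
      using \<open>N > 0\<close> unfolding N_def[symmetric] by (simp add: field_simps)
  qed
  finally show ?thesis .
qed

lemma center_moment_odd: "odd n \<Longrightarrow> center_moment n = 0"
  by (simp add: center_moment_def)

text \<open>There is no linear term, because the two equations for \<psi>_3 or \<psi>_4 fix the
  pairings with u^3 and u^5 but not the one with u. All four radicands have this shape.\<close>

definition quintic :: "real \<Rightarrow> real \<Rightarrow> real \<Rightarrow> real \<Rightarrow> real \<Rightarrow> real \<Rightarrow> real" where
  "quintic g0 g2 g3 g4 g5 x = g0 + g2 * x ^ 2 + g3 * x ^ 3 + g4 * x ^ 4 + g5 * x ^ 5"

text \<open>Each \<psi>_i is u^s times an even polynomial of degree at most 4, with s = 0, 2, 1, 3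
  in turn, so this one integral serves all four.\<close>

lemma has_integral_times_quintic:
  fixes g0 g2 g3 g4 g5 :: real
  defines "m \<equiv> center_moment"
  shows "((\<lambda>u. (u - 1/2) ^ s * (p0 + p1 * (u - 1/2) ^ 2 + p2 * (u - 1/2) ^ 4) * quintic g0 g2 g3 g4 g5 (u - 1/2))
    has_integral g0 * (p0 * m s + p1 * m (s + 2) + p2 * m (s + 4))
      + g2 * (p0 * m (s + 2) + p1 * m (s + 4) + p2 * m (s + 6))
      + g3 * (p0 * m (s + 3) + p1 * m (s + 5) + p2 * m (s + 7))
      + g4 * (p0 * m (s + 4) + p1 * m (s + 6) + p2 * m (s + 8))
      + g5 * (p0 * m (s + 5) + p1 * m (s + 7) + p2 * m (s + 9))) {0..1}"
proof -
  have "((\<lambda>u. g0 * (p0 * (u - 1/2) ^ s + p1 * (u - 1/2) ^ (s + 2) + p2 * (u - 1/2) ^ (s + 4))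
      + g2 * (p0 * (u - 1/2) ^ (s + 2) + p1 * (u - 1/2) ^ (s + 4) + p2 * (u - 1/2) ^ (s + 6))
      + g3 * (p0 * (u - 1/2) ^ (s + 3) + p1 * (u - 1/2) ^ (s + 5) + p2 * (u - 1/2) ^ (s + 7))
      + g4 * (p0 * (u - 1/2) ^ (s + 4) + p1 * (u - 1/2) ^ (s + 6) + p2 * (u - 1/2) ^ (s + 8))
      + g5 * (p0 * (u - 1/2) ^ (s + 5) + p1 * (u - 1/2) ^ (s + 7) + p2 * (u - 1/2) ^ (s + 9)))
    has_integral g0 * (p0 * m s + p1 * m (s + 2) + p2 * m (s + 4))
      + g2 * (p0 * m (s + 2) + p1 * m (s + 4) + p2 * m (s + 6))
      + g3 * (p0 * m (s + 3) + p1 * m (s + 5) + p2 * m (s + 7))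
      + g4 * (p0 * m (s + 4) + p1 * m (s + 6) + p2 * m (s + 8))
      + g5 * (p0 * m (s + 5) + p1 * m (s + 7) + p2 * m (s + 9))) {0..1}"
    by (intro has_integral_add has_integral_mult_right has_integral_center_moment[folded m_def])
  moreover have "x ^ s * (p0 + p1 * x ^ 2 + p2 * x ^ 4) * quintic g0 g2 g3 g4 g5 x =
      g0 * (p0 * x ^ s + p1 * x ^ (s + 2) + p2 * x ^ (s + 4))
      + g2 * (p0 * x ^ (s + 2) + p1 * x ^ (s + 4) + p2 * x ^ (s + 6))
      + g3 * (p0 * x ^ (s + 3) + p1 * x ^ (s + 5) + p2 * x ^ (s + 7))
      + g4 * (p0 * x ^ (s + 4) + p1 * x ^ (s + 6) + p2 * x ^ (s + 8))
      + g5 * (p0 * x ^ (s + 5) + p1 * x ^ (s + 7) + p2 * x ^ (s + 9))" for x :: real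
  proof -
    have "x ^ 5 = x ^ 2 * x ^ 3" "x ^ 6 = x ^ 2 * x ^ 4" "x ^ 7 = x ^ 4 * x ^ 3" "x ^ 8 = x ^ 4 * x ^ 4" "x ^ 9 = x ^ 4 * x ^ 5" for x :: real
      by (simp_all flip: power_add)
    note * = this
    show ?thesis
      unfolding quintic_def power_add * by (simp add: algebra_simps)
  qed
  ultimately show ?thesis
    by simp
qed

text \<open>Parity removes \<open>g3\<close> and \<open>g5\<close>, the moment equations remove
  \<open>g0\<close> and \<open>g4\<close>. The factor 1/6 will cancel the 6 in
  \<open>6 * t ^ 2 + 1/2\<close>.\<close>

lemma has_integral_psi1_quintic:
  "((\<lambda>u. psi1 (u - 1/2) * quintic g0 g2 g3 g4 g5 (u - 1/2)) has_integral g2 / 6) {0..1}"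
proof -
  have *: "a1 $ 0 * center_moment 0 + a1 $ 1 * center_moment (0 + 2) + a1 $ 2 * center_moment (0 + 4) = 0"
    "a1 $ 0 * center_moment (0 + 2) + a1 $ 1 * center_moment (0 + 4) + a1 $ 2 * center_moment (0 + 6) = 1 / 6"
    "a1 $ 0 * center_moment (0 + 4) + a1 $ 1 * center_moment (0 + 6) + a1 $ 2 * center_moment (0 + 8) = 0"
    using a1_moments by (simp_all add: center_moment_def)
  show ?thesis
    using has_integral_times_quintic[of 0 "a1 $ 0" "a1 $ 1" "a1 $ 2" g0 g2 g3 g4 g5]
    unfolding * by (simp add: psi1_def center_moment_odd)
qed

lemma has_integral_psi2_quintic:
  "((\<lambda>u. psi2 (u - 1/2) * quintic g0 g2 g3 g4 g5 (u - 1/2)) has_integral g4 / 20) {0..1}"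
proof -
  have *: "a2 $ 0 * center_moment 2 + a2 $ 1 * center_moment (2 + 2) + a2 $ 2 * center_moment (2 + 4) = 0"
    "a2 $ 0 * center_moment (2 + 2) + a2 $ 1 * center_moment (2 + 4) + a2 $ 2 * center_moment (2 + 6) = 0"
    "a2 $ 0 * center_moment (2 + 4) + a2 $ 1 * center_moment (2 + 6) + a2 $ 2 * center_moment (2 + 8) = 1 / 20"
    using a2_moments by (simp_all add: center_moment_def)
  have [simp]: "psi2 x = x ^ 2 * (a2 $ 0 + a2 $ 1 * x ^ 2 + a2 $ 2 * x ^ 4)" for x
    by (simp add: psi2_def eval_nat_numeral algebra_simps)
  show ?thesis
    using has_integral_times_quintic[of 2 "a2 $ 0" "a2 $ 1" "a2 $ 2" g0 g2 g3 g4 g5]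
    unfolding * by (simp add: center_moment_odd)
qed

lemma has_integral_psi3_quintic:
  "((\<lambda>u. psi3 (u - 1/2) * quintic g0 g2 g3 g4 g5 (u - 1/2)) has_integral g5) {0..1}"
proof -
  have *: "b1 $ 0 * center_moment (1 + 3) + b1 $ 1 * center_moment (1 + 5) + 0 * center_moment (1 + 7) = 0"
    "b1 $ 0 * center_moment (1 + 5) + b1 $ 1 * center_moment (1 + 7) + 0 * center_moment (1 + 9) = 1"
    using b1_moments by (simp_all add: center_moment_def)
  have [simp]: "psi3 x = x ^ 1 * (b1 $ 0 + b1 $ 1 * x ^ 2 + 0 * x ^ 4)" for x
    by (simp add: psi3_def eval_nat_numeral algebra_simps)
  show ?thesis
    using has_integral_times_quintic[of 1 "b1 $ 0" "b1 $ 1" 0 g0 g2 g3 g4 g5]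
    unfolding * by (simp add: center_moment_odd)
qed

lemma has_integral_psi4_quintic:
  "((\<lambda>u. psi4 (u - 1/2) * quintic g0 g2 g3 g4 g5 (u - 1/2)) has_integral g3) {0..1}"
proof -
  have *: "b2 $ 0 * center_moment (3 + 3) + b2 $ 1 * center_moment (3 + 5) + 0 * center_moment (3 + 7) = 1"
    "b2 $ 0 * center_moment (3 + 5) + b2 $ 1 * center_moment (3 + 7) + 0 * center_moment (3 + 9) = 0"
    using b2_moments by (simp_all add: center_moment_def)
  have [simp]: "psi4 x = x ^ 3 * (b2 $ 0 + b2 $ 1 * x ^ 2 + 0 * x ^ 4)" for x
    by (simp add: psi4_def eval_nat_numeral algebra_simps)
  show ?thesis
    using has_integral_times_quintic[of 3 "b2 $ 0" "b2 $ 1" 0 g0 g2 g3 g4 g5]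
    unfolding * by (simp add: center_moment_odd)
qed

text \<open>The constant 1 of the kernel contributes the mean of the polynomial; each root term
  contributes the one coefficient that its \<psi>_i detects.\<close>

lemma has_integral_K_tilde_quintic:
  "((\<lambda>u. K_tilde t (u - 1/2) k * quintic g0 g2 g3 g4 g5 (u - 1/2)) has_integral
    g0 + g2 / 12 + g4 / 80
    + (root k (20 * t ^ 4 + 3/4) - 1) * (g2 / 6) + (root k (6 * t ^ 2 + 1/2) - 1) * (g4 / 20)
    + (root k (t ^ 3 + 1) - 1) * g5 + (root k (t ^ 5 + 1) - 1) * g3) {0..1}"
proof -
  have "((\<lambda>u. quintic g0 g2 g3 g4 g5 (u - 1/2)) has_integral g0 + g2 / 12 + g4 / 80) {0..1}"
    using has_integral_times_quintic[of 0 1 0 0 g0 g2 g3 g4 g5] by (simp add: center_moment_def)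
  from has_integral_add[OF has_integral_add[OF has_integral_add[OF has_integral_add[OF this
      has_integral_mult_right[OF has_integral_psi1_quintic]]
      has_integral_mult_right[OF has_integral_psi2_quintic]]
      has_integral_mult_right[OF has_integral_psi3_quintic]]
      has_integral_mult_right[OF has_integral_psi4_quintic]]
  show ?thesis
    by (rule has_integral_eq[rotated]) (simp add: K_tilde_def algebra_simps)
qed

section \<open>Positivity and integrals over the unit interval\<close>

lemma measurable_unit_lebesgue [measurable]:
  "f \<in> borel_measurable borel \<Longrightarrow> f \<in> borel_measurable unit_lebesgue"
  unfolding unit_lebesgue_def by (intro measurable_restrict_space1) simp

lemma space_unit_lebesgue [simp]: "space unit_lebesgue = {0..1}"
  by (simp add: unit_lebesgue_def space_restrict_space)

lemma prob_space_unit_lebesgue: "prob_space unit_lebesgue"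
  by (rule prob_spaceI) (simp add: unit_lebesgue_def emeasure_restrict_space space_restrict_space)

text \<open>Bridge from the gauge integral, in which the kernel identities are computed, to the
  nonnegative integral used for the measures. Cutting \<open>f\<close> off outside [0,1] makes
  nonnegativity there sufficient.\<close>

lemma nn_integral_unit_lebesgue:
  fixes f :: "real \<Rightarrow> real"
  assumes "f \<in> borel_measurable borel" "(f has_integral I) {0..1}" "\<And>u. u \<in> {0..1} \<Longrightarrow> 0 \<le> f u"
  shows "(\<integral>\<^sup>+u. ennreal (f u) \<partial>unit_lebesgue) = ennreal I"
proof -
  have "(\<integral>\<^sup>+u. ennreal (f u) \<partial>unit_lebesgue) = (\<integral>\<^sup>+u. ennreal (f u) * indicator {0..1} u \<partial>lborel)"
    unfolding unit_lebesgue_def by (rule nn_integral_restrict_space) simp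
  also have "\<dots> = (\<integral>\<^sup>+u. ennreal (if u \<in> {0..1} then f u else 0) \<partial>lborel)"
    by (intro nn_integral_cong) (simp split: split_indicator)
  also have "\<dots> = ennreal I"
  proof (rule nn_integral_has_integral_lborel)
    show "(\<lambda>u. if u \<in> {0..1} then f u else 0) \<in> borel_measurable borel"
      using assms(1) by measurable
    show "((\<lambda>u. if u \<in> {0..1} then f u else 0) has_integral I) UNIV"
      using assms(2) by (simp only: has_integral_restrict_UNIV)
  qed (use assms(3) in auto)
  finally show ?thesis .
qed

section \<open>Positivity of the kernel for large k\<close>

lemma continuous_on_K_tilde:
  "continuous_on UNIV (\<lambda>p. K_tilde (fst p - 1/2) (snd p - 1/2) k)"
  unfolding K_tilde_def psi1_def psi2_def psi3_def psi4_def by (intro continuous_intros)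

lemma psi_bounded:
  "\<exists>B>0. \<forall>u. \<bar>u\<bar> \<le> 1 \<longrightarrow> \<bar>psi1 u\<bar> \<le> B \<and> \<bar>psi2 u\<bar> \<le> B \<and> \<bar>psi3 u\<bar> \<le> B \<and> \<bar>psi4 u\<bar> \<le> B"
proof -
  have *: "\<exists>B. \<forall>u\<in>{-1..1}. \<bar>f u\<bar> \<le> B" if "continuous_on {-1..1} f" for f :: "real \<Rightarrow> real"
    using compact_imp_bounded[OF compact_continuous_image[OF that compact_Icc]]
    by (simp add: bounded_iff)
  have c: "continuous_on {-1..1} psi1" "continuous_on {-1..1} psi2"
    "continuous_on {-1..1} psi3" "continuous_on {-1..1} psi4"
    unfolding psi1_def psi2_def psi3_def psi4_def by (intro continuous_intros)+
  obtain B1 B2 B3 B4 where B: "\<forall>u\<in>{-1..1}. \<bar>psi1 u\<bar> \<le> B1" "\<forall>u\<in>{-1..1}. \<bar>psi2 u\<bar> \<le> B2"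
    "\<forall>u\<in>{-1..1}. \<bar>psi3 u\<bar> \<le> B3" "\<forall>u\<in>{-1..1}. \<bar>psi4 u\<bar> \<le> B4"
    using *[OF c(1)] *[OF c(2)] *[OF c(3)] *[OF c(4)] by blast
  have "\<bar>u\<bar> \<le> 1 \<longleftrightarrow> u \<in> {-1..1}" for u :: real
    by auto
  \<comment> \<open>The extra 1 in the maximum keeps the bound positive, so that it may be divided
    by.\<close>
  with B show ?thesis
    by (intro exI[of _ "max 1 (max (max B1 B2) (max B3 B4))"]) (auto simp: le_max_iff_disj)
qed

text \<open>A common interval for all four; it is sharp, since \<open>6 * t ^ 2 + 1/2\<close> is 1/2
  at 0 and 2 at both ends.\<close>

lemma radicands_bounded:
  fixes t :: real
  assumes "\<bar>t\<bar> \<le> 1/2"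
  shows "20 * t ^ 4 + 3/4 \<in> {1/2..2}" "6 * t ^ 2 + 1/2 \<in> {1/2..2}" "t ^ 3 + 1 \<in> {1/2..2}" "t ^ 5 + 1 \<in> {1/2..2}"
proof -
  have *: "\<bar>t ^ n\<bar> \<le> (1/2) ^ n" for n
    using assms by (simp only: power_abs power_mono abs_ge_zero)
  have "0 \<le> t ^ 4" "t ^ 4 \<le> 1/16"
    using *[of 4] by (simp_all add: power_divide)
  then show "20 * t ^ 4 + 3/4 \<in> {1/2..2}"
    unfolding atLeastAtMost_iff by linarith
  have "0 \<le> t ^ 2" "t ^ 2 \<le> 1/4"
    using *[of 2] by (simp_all add: power_divide)
  then show "6 * t ^ 2 + 1/2 \<in> {1/2..2}"
    unfolding atLeastAtMost_iff by linarith
  have "\<bar>t ^ 3\<bar> \<le> 1/8"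
    using *[of 3] by (simp add: power_divide)
  then show "t ^ 3 + 1 \<in> {1/2..2}"
    unfolding atLeastAtMost_iff by linarith
  have "\<bar>t ^ 5\<bar> \<le> 1/32"
    using *[of 5] by (simp add: power_divide)
  then show "t ^ 5 + 1 \<in> {1/2..2}"
    unfolding atLeastAtMost_iff by linarith
qed

text \<open>The roots tend to 1 uniformly for radicands in [1/2, 2] (monotonicity reduces this to
  the two endpoints) and the \<psi>_i are bounded, so the kernel tends to 1 uniformly.\<close>

lemma K_tilde_eventually_positive: "\<exists>k0\<ge>2. K_tilde_positive_from k0"
proof -
  obtain B where B: "B > 0" "\<And>u. \<bar>u\<bar> \<le> 1 \<Longrightarrow> \<bar>psi1 u\<bar> \<le> B \<and> \<bar>psi2 u\<bar> \<le> B \<and> \<bar>psi3 u\<bar> \<le> B \<and> \<bar>psi4 u\<bar> \<le> B"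
    using psi_bounded by blast
  \<comment> \<open>With this \<open>e\<close> each of the four perturbing terms is at least -1/5,
    which leaves at least 1/5 of the leading 1.\<close>
  define e where "e = 1 / (5 * B)"
  have "e > 0"
    using B by (simp add: e_def)
  have "\<forall>\<^sub>F k in sequentially. root k 2 < 1 + e"
    using order_tendstoD(2)[OF LIMSEQ_root_const[of 2]] \<open>e > 0\<close> by simp
  moreover have "\<forall>\<^sub>F k in sequentially. 1 - e < root k (1/2)"
    using order_tendstoD(1)[OF LIMSEQ_root_const[of "1/2"]] \<open>e > 0\<close> by simp
  ultimately have "\<forall>\<^sub>F k in sequentially. 2 \<le> k \<and> root k 2 < 1 + e \<and> 1 - e < root k (1/2)"
    using eventually_ge_at_top[of 2] by eventually_elim simp
  then obtain k0 where k0: "\<And>k. k0 \<le> k \<Longrightarrow> 2 \<le> k \<and> root k 2 < 1 + e \<and> 1 - e < root k (1/2)"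
    by (auto simp: eventually_sequentially)
  have pos: "K_tilde t u k > 0" if k: "k0 \<le> k" and t: "\<bar>t\<bar> \<le> 1/2" and u: "\<bar>u\<bar> \<le> 1/2" for k t u
  proof -
    have r: "\<bar>root k s - 1\<bar> \<le> e" if "s \<in> {1/2..2}" for s
    proof -
      have "root k (1/2) \<le> root k s" "root k s \<le> root k 2"
        using that k0[OF k] by (auto intro!: real_root_le_mono)
      then show ?thesis
        using k0[OF k] by linarith
    qed
    have *: "- (1/5) \<le> p * (root k s - 1)" if "\<bar>p\<bar> \<le> B" "s \<in> {1/2..2}" for p s
    proof -
      have "\<bar>p * (root k s - 1)\<bar> \<le> B * e"
        unfolding abs_mult using that r B(1) by (intro mult_mono) auto
      then have "\<bar>p * (root k s - 1)\<bar> \<le> 1/5"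
        using B(1) by (simp add: e_def)
      then show ?thesis
        by linarith
    qed
    have sum_pos: "0 < 1 + a + b + c + d"
      if "- (1/5) \<le> a" "- (1/5) \<le> b" "- (1/5) \<le> c" "- (1/5) \<le> d" for a b c d :: real
      using that by linarith
    have "\<bar>psi1 u\<bar> \<le> B" "\<bar>psi2 u\<bar> \<le> B" "\<bar>psi3 u\<bar> \<le> B" "\<bar>psi4 u\<bar> \<le> B"
      using B(2)[of u] u by auto
    then show ?thesis
      unfolding K_tilde_def by (intro sum_pos * radicands_bounded t)
  qed
  have "K_tilde_positive_from k0"
    unfolding K_tilde_positive_from_def
  proof (intro allI ballI impI)
    fix k t u
    assume "k0 \<le> k" "t \<in> {0..1::real}" "u \<in> {0..1::real}"
    then show "0 < K_tilde (t - 1/2) (u - 1/2) k"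
      by (intro pos) (simp_all only: abs_le_iff atLeastAtMost_iff, linarith+)
  qed
  then show ?thesis
    using k0[of k0] by blast
qed

section \<open>Kolmogorov extension on the cube\<close>

lemma space_lambda_prod: "space (lambda_prod B) = B \<rightarrow>\<^sub>E {0..1}"
  by (simp add: lambda_prod_def space_PiM)

lemma measurable_lambda_prod_component:
  "x \<in> B \<Longrightarrow> (\<lambda>\<sigma>. \<sigma> x) \<in> measurable (lambda_prod B) unit_lebesgue"
  unfolding lambda_prod_def by (rule measurable_component_singleton)

lemma borel_measurable_lambda_prod_component [measurable (raw)]:
  "x \<in> B \<Longrightarrow> (\<lambda>\<sigma>. \<sigma> x) \<in> borel_measurable (lambda_prod B)"
  by (rule measurable_compose[OF measurable_lambda_prod_component]) measurable

lemma measurable_lambda_prod_restrict: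
  "J \<subseteq> B \<Longrightarrow> (\<lambda>\<sigma>. restrict \<sigma> J) \<in> measurable (lambda_prod B) (lambda_prod J)"
  unfolding lambda_prod_def by (rule measurable_restrict_subset)

lemma measurable_lambda_prod_restrict_borel:
  "J \<subseteq> B \<Longrightarrow> (\<lambda>\<sigma>. restrict \<sigma> J) \<in> measurable (lambda_prod B) (PiM J (\<lambda>_. borel))"
  by (intro measurable_restrict borel_measurable_lambda_prod_component) auto

text \<open>The library extension theorem needs a Polish space as a type, so the limit is built over \<open>\<real>\<close> and
  pushed back into \<open>[0,1]\<close> by a map that fixes the interval.\<close>
definition clamp01 :: "real \<Rightarrow> real" where
  "clamp01 t = max 0 (min 1 t)"

lemma measurable_clamp01: "clamp01 \<in> measurable borel unit_lebesgue"
  unfolding unit_lebesgue_def clamp01_def [abs_def]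
  by (intro measurable_restrict_space2) auto

text \<open>The limit is characterised by its values on cylinder sets; this turns them into
  equalities of finite marginals, stated existentially so that the result can be used for a family
  built inside another proof.\<close>

lemma (in polish_projective) exists_limit:
  "\<exists>\<mu>. prob_space \<mu> \<and> sets \<mu> = sets (PiM I (\<lambda>_. borel)) \<and>
    (\<forall>J. finite J \<longrightarrow> J \<subseteq> I \<longrightarrow> distr \<mu> (PiM J (\<lambda>_. borel)) (\<lambda>\<sigma>. restrict \<sigma> J) = P J)"
proof (intro exI conjI allI impI)
  show "prob_space lim"
    by (rule P.prob_space_axioms)
  show "sets lim = sets (PiM I (\<lambda>_. borel))"
    by (rule sets_lim)
  fix J assume J: "finite J" "J \<subseteq> I"
  show "distr lim (PiM J (\<lambda>_. borel)) (\<lambda>\<sigma>. restrict \<sigma> J) = P J"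
  proof (rule measure_eqI)
    fix X assume "X \<in> sets (distr lim (PiM J (\<lambda>_. borel)) (\<lambda>\<sigma>. restrict \<sigma> J))"
    then have X: "X \<in> sets (PiM J (\<lambda>_. borel))"
      by simp
    have "(\<lambda>\<sigma>. restrict \<sigma> J) \<in> measurable lim (PiM J (\<lambda>_. borel))"
      using measurable_restrict_subset[OF J(2)] by (simp cong: measurable_cong_sets)
    then have "emeasure (distr lim (PiM J (\<lambda>_. borel)) (\<lambda>\<sigma>. restrict \<sigma> J)) X = emeasure lim (emb I J X)"
      using X by (simp add: emeasure_distr prod_emb_def space_PiM)
    also have "\<dots> = emeasure (P J) X"
      using J X by (intro emeasure_lim_emb)
    finally show "emeasure (distr lim (PiM J (\<lambda>_. borel)) (\<lambda>\<sigma>. restrict \<sigma> J)) X = emeasure (P J) X" .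
  qed (simp add: sets_P J)
qed

text \<open>Consistency along an increasing chain of finite sets exhausting \<open>V\<close>
  determines consistent marginals on all finite subsets, to which the extension theorem
  applies.\<close>

lemma exists_measure_with_marginals:
  fixes V :: "'v set" and B :: "nat \<Rightarrow> 'v set" and \<nu> :: "nat \<Rightarrow> ('v \<Rightarrow> real) measure"
  assumes B: "\<And>n. finite (B n)" "\<And>n. B n \<subseteq> V" "\<And>n. B n \<subseteq> B (Suc n)"
    and exhaust: "\<And>J. finite J \<Longrightarrow> J \<subseteq> V \<Longrightarrow> \<exists>n. J \<subseteq> B n"
    and prob: "\<And>n. prob_space (\<nu> n)" and sets_\<nu>: "\<And>n. sets (\<nu> n) = sets (lambda_prod (B n))"
    and consistent: "\<And>n. distr (\<nu> (Suc n)) (lambda_prod (B n)) (\<lambda>\<sigma>. restrict \<sigma> (B n)) = \<nu> n"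
  obtains \<mu> where "prob_space \<mu>" "sets \<mu> = sets (PiM V (\<lambda>_. unit_lebesgue))"
    "\<And>n. distr \<mu> (lambda_prod (B n)) (\<lambda>\<sigma>. restrict \<sigma> (B n)) = \<nu> n"
proof -
  have mono: "m \<le> n \<Longrightarrow> B m \<subseteq> B n" for m n
    using B(3) by (rule lift_Suc_mono_le)
  have meas_\<nu>: "measurable (\<nu> n) M = measurable (lambda_prod (B n)) M" for n and M :: "'b measure"
    using sets_\<nu> by (rule measurable_cong_sets) simp
  have space_\<nu>: "space (\<nu> n) = B n \<rightarrow>\<^sub>E {0..1}" for n
    using sets_eq_imp_space_eq[OF sets_\<nu>] by (simp add: space_lambda_prod)
  have marginal: "distr (\<nu> n) (lambda_prod (B m)) (\<lambda>\<sigma>. restrict \<sigma> (B m)) = \<nu> m" if "m \<le> n" for m n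
    using that
  proof (induction rule: dec_induct)
    case base
    have "distr (\<nu> m) (lambda_prod (B m)) (\<lambda>\<sigma>. restrict \<sigma> (B m)) = distr (\<nu> m) (\<nu> m) (\<lambda>\<sigma>. \<sigma>)"
      by (rule distr_cong) (auto simp: sets_\<nu> space_\<nu> PiE_restrict)
    also have "\<dots> = \<nu> m"
      by (rule distr_id)
    finally show ?case .
  next
    case (step n)
    have "\<nu> m = distr (distr (\<nu> (Suc n)) (lambda_prod (B n)) (\<lambda>\<sigma>. restrict \<sigma> (B n)))
        (lambda_prod (B m)) (\<lambda>\<sigma>. restrict \<sigma> (B m))"
      by (simp only: consistent step.IH)
    also have "\<dots> = distr (\<nu> (Suc n)) (lambda_prod (B m)) ((\<lambda>\<sigma>. restrict \<sigma> (B m)) \<circ> (\<lambda>\<sigma>. restrict \<sigma> (B n)))"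
      by (intro distr_distr) (simp_all add: meas_\<nu> measurable_lambda_prod_restrict mono[OF step(1)] B(3))
    also have "(\<lambda>\<sigma>. restrict \<sigma> (B m)) \<circ> (\<lambda>\<sigma>. restrict \<sigma> (B n)) = (\<lambda>\<sigma> :: 'v \<Rightarrow> real. restrict \<sigma> (B m))"
      using mono[OF step(1)] by (auto simp: fun_eq_iff restrict_def)
    finally show ?case ..
  qed
  \<comment> \<open>\<open>LEAST\<close> merely selects a level containing \<open>J\<close>; by
    \<open>P_eq\<close> every such level yields the same marginal.\<close>
  define P :: "'v set \<Rightarrow> ('v \<Rightarrow> real) measure"
    where "P J = distr (\<nu> (LEAST n. J \<subseteq> B n)) (PiM J (\<lambda>_. borel)) (\<lambda>\<sigma>. restrict \<sigma> J)" for J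
  have P_eq: "P J = distr (\<nu> n) (PiM J (\<lambda>_. borel)) (\<lambda>\<sigma>. restrict \<sigma> J)" if "J \<subseteq> B n" for J n
  proof -
    let ?m = "LEAST n. J \<subseteq> B n"
    have m: "?m \<le> n" "J \<subseteq> B ?m"
      using Least_le[of "\<lambda>n. J \<subseteq> B n", OF that] LeastI[of "\<lambda>n. J \<subseteq> B n", OF that] by simp_all
    have "P J = distr (distr (\<nu> n) (lambda_prod (B ?m)) (\<lambda>\<sigma>. restrict \<sigma> (B ?m))) (PiM J (\<lambda>_. borel)) (\<lambda>\<sigma>. restrict \<sigma> J)"
      by (simp add: P_def marginal[OF m(1)])
    also have "\<dots> = distr (\<nu> n) (PiM J (\<lambda>_. borel)) ((\<lambda>\<sigma>. restrict \<sigma> J) \<circ> (\<lambda>\<sigma>. restrict \<sigma> (B ?m)))"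
      by (intro distr_distr)
        (simp_all add: meas_\<nu> measurable_lambda_prod_restrict measurable_lambda_prod_restrict_borel m mono)
    also have "(\<lambda>\<sigma>. restrict \<sigma> J) \<circ> (\<lambda>\<sigma>. restrict \<sigma> (B ?m)) = (\<lambda>\<sigma> :: 'v \<Rightarrow> real. restrict \<sigma> J)"
      using m by (auto simp: fun_eq_iff restrict_def)
    finally show ?thesis .
  qed
  have P_projective: "polish_projective V P"
  proof (rule polish_projective.intro, rule projective_family.intro)
    fix J H assume JH: "J \<subseteq> H" "finite H" "H \<subseteq> V"
    obtain n where n: "H \<subseteq> B n"
      using exhaust JH by blast
    have "distr (P H) (PiM J (\<lambda>_. borel)) (\<lambda>\<sigma>. restrict \<sigma> J)
        = distr (\<nu> n) (PiM J (\<lambda>_. borel)) ((\<lambda>\<sigma>. restrict \<sigma> J) \<circ> (\<lambda>\<sigma>. restrict \<sigma> H))"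
      unfolding P_eq[OF n]
      by (intro distr_distr) (simp_all add: meas_\<nu> measurable_restrict_subset measurable_lambda_prod_restrict_borel JH n)
    also have "(\<lambda>\<sigma>. restrict \<sigma> J) \<circ> (\<lambda>\<sigma>. restrict \<sigma> H) = (\<lambda>\<sigma> :: 'v \<Rightarrow> real. restrict \<sigma> J)"
      using JH by (auto simp: fun_eq_iff restrict_def)
    finally show "P J = distr (P H) (PiM J (\<lambda>_. borel)) (\<lambda>\<sigma>. restrict \<sigma> J)"
      using P_eq[OF order_trans[OF JH(1) n]] by (simp only:)
  next
    fix J :: "'v set" assume "finite J" "J \<subseteq> V"
    then obtain n where n: "J \<subseteq> B n"
      using exhaust by blast
    show "prob_space (P J)"
      unfolding P_eq[OF n]
      by (rule prob_space.prob_space_distr[OF prob])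
        (simp only: meas_\<nu> measurable_lambda_prod_restrict_borel[OF n])
  qed
  have "\<exists>\<mu>\<^sub>0. prob_space \<mu>\<^sub>0 \<and> sets \<mu>\<^sub>0 = sets (PiM V (\<lambda>_. borel)) \<and>
    (\<forall>J. finite J \<longrightarrow> J \<subseteq> V \<longrightarrow> distr \<mu>\<^sub>0 (PiM J (\<lambda>_. borel)) (\<lambda>\<sigma>. restrict \<sigma> J) = P J)"
    by (rule polish_projective.exists_limit[OF P_projective])
  then obtain \<mu>\<^sub>0 where \<mu>\<^sub>0: "prob_space \<mu>\<^sub>0" "sets \<mu>\<^sub>0 = sets (PiM V (\<lambda>_. borel))"
    "\<And>J. finite J \<Longrightarrow> J \<subseteq> V \<Longrightarrow> distr \<mu>\<^sub>0 (PiM J (\<lambda>_. borel)) (\<lambda>\<sigma>. restrict \<sigma> J) = P J"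
    by (elim exE conjE) simp
  let ?c = "\<lambda>J (\<sigma> :: 'v \<Rightarrow> real). \<lambda>x\<in>J. clamp01 (\<sigma> x)"
  \<comment> \<open>Clamping every coordinate produces a measure on the cube without first proving
    that the cube has full measure under \<open>\<mu>\<^sub>0\<close>.\<close>
  define \<mu> where "\<mu> = distr \<mu>\<^sub>0 (PiM V (\<lambda>_. unit_lebesgue)) (?c V)"
  have meas_c: "?c J \<in> measurable (PiM J (\<lambda>_. borel)) (PiM J (\<lambda>_. unit_lebesgue))" for J
    by (intro measurable_restrict measurable_compose[OF _ measurable_clamp01] measurable_component_singleton)
  have meas_lim: "measurable \<mu>\<^sub>0 M = measurable (PiM V (\<lambda>_. borel)) M" for M :: "'b measure"
    by (rule measurable_cong_sets) (simp_all add: \<mu>\<^sub>0)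
  have "distr \<mu> (lambda_prod (B n)) (\<lambda>\<sigma>. restrict \<sigma> (B n)) = \<nu> n" for n
  proof -
    have "distr \<mu> (lambda_prod (B n)) (\<lambda>\<sigma>. restrict \<sigma> (B n))
        = distr \<mu>\<^sub>0 (lambda_prod (B n)) ((\<lambda>\<sigma>. restrict \<sigma> (B n)) \<circ> ?c V)"
      unfolding \<mu>_def lambda_prod_def
      by (rule distr_distr) (simp_all add: meas_lim meas_c B measurable_restrict_subset)
    also have "(\<lambda>\<sigma>. restrict \<sigma> (B n)) \<circ> ?c V = ?c (B n) \<circ> (\<lambda>\<sigma>. restrict \<sigma> (B n))"
      using B by (auto simp: fun_eq_iff restrict_def)
    also have "distr \<mu>\<^sub>0 (lambda_prod (B n)) \<dots>
        = distr (distr \<mu>\<^sub>0 (PiM (B n) (\<lambda>_. borel)) (\<lambda>\<sigma>. restrict \<sigma> (B n))) (lambda_prod (B n)) (?c (B n))"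
      unfolding lambda_prod_def
      by (rule distr_distr[symmetric]) (simp_all add: meas_lim meas_c B measurable_restrict_subset)
    also have "\<dots> = distr (\<nu> n) (lambda_prod (B n)) (?c (B n) \<circ> (\<lambda>\<sigma>. restrict \<sigma> (B n)))"
      unfolding \<mu>\<^sub>0(3)[OF B(1,2)] P_eq[OF order_refl] lambda_prod_def
      by (rule distr_distr) (simp_all add: meas_\<nu> meas_c measurable_lambda_prod_restrict_borel)
    \<comment> \<open>\<open>\<nu> n\<close> already lives on the cube, where clamping changes
      nothing.\<close>
    also have "\<dots> = distr (\<nu> n) (\<nu> n) (\<lambda>\<sigma>. \<sigma>)"
    proof (rule distr_cong)
      fix \<sigma> assume "\<sigma> \<in> space (\<nu> n)"
      then have \<sigma>: "\<sigma> \<in> B n \<rightarrow>\<^sub>E {0..1}"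
        by (simp add: space_\<nu>)
      show "(?c (B n) \<circ> (\<lambda>\<sigma>. restrict \<sigma> (B n))) \<sigma> = \<sigma>"
      proof
        fix x
        show "(?c (B n) \<circ> (\<lambda>\<sigma>. restrict \<sigma> (B n))) \<sigma> x = \<sigma> x"
          using PiE_mem[OF \<sigma>, of x] PiE_arb[OF \<sigma>, of x] by (auto simp: clamp01_def)
      qed
    qed (simp_all add: sets_\<nu>)
    also have "\<dots> = \<nu> n"
      by (rule distr_id)
    finally show ?thesis .
  qed
  moreover have "prob_space \<mu>"
    unfolding \<mu>_def by (rule prob_space.prob_space_distr[OF \<mu>\<^sub>0(1)]) (simp only: meas_lim meas_c)
  moreover have "sets \<mu> = sets (PiM V (\<lambda>_. unit_lebesgue))"
    by (simp add: \<mu>_def)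
  ultimately show ?thesis
    using that by blast
qed

section \<open>Levels of a rooted Cayley tree\<close>

locale rooted_cayley_tree =
  fixes k :: nat and V :: "'v set" and L :: "'v set set" and x0 :: 'v
  assumes cayley: "cayley_tree k V L" and root: "x0 \<in> V"
begin

abbreviation level :: "'v \<Rightarrow> nat" where "level x \<equiv> graph_dist L x x0"
abbreviation ball where "ball \<equiv> ball_V V L x0"
abbreviation sphere where "sphere \<equiv> sphere_W V L x0"

definition children :: "'v \<Rightarrow> 'v set" where
  "children x = {y. direct_successor L x0 x y}"

definition edges_up_to :: "nat \<Rightarrow> ('v \<times> 'v) set" where
  "edges_up_to n = {(x, y). x \<in> ball n \<and> y \<in> ball n \<and> direct_successor L x0 x y}"

lemma edgeD:
  assumes "{x, y} \<in> L"
  shows "x \<in> V" "y \<in> V" "x \<noteq> y"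
  using assms cayley
  by (auto simp: cayley_tree_def is_tree_def simple_graph_def doubleton_eq_iff)

lemma no_graph_cycle: "\<not> graph_cycle L p"
  using cayley by (auto simp: cayley_tree_def is_tree_def)

lemma level_relpow: "x \<in> V \<Longrightarrow> (x, x0) \<in> adjacency L ^^ level x"
proof -
  assume "x \<in> V"
  then have "(x, x0) \<in> (adjacency L)\<^sup>*"
    using cayley root by (auto simp: cayley_tree_def is_tree_def)
  then obtain n where "(x, x0) \<in> adjacency L ^^ n"
    using rtrancl_power by blast
  then show ?thesis
    unfolding graph_dist_def by (rule LeastI)
qed

lemma level_le: "(x, x0) \<in> adjacency L ^^ n \<Longrightarrow> level x \<le> n"
  unfolding graph_dist_def by (rule Least_le)

lemma level_eq_0_iff: "x \<in> V \<Longrightarrow> level x = 0 \<longleftrightarrow> x = x0"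
  using level_relpow[of x] level_le[of x 0] by auto

lemma level_root [simp]: "level x0 = 0"
  using level_eq_0_iff root by blast

lemma level_edge_le: "{x, y} \<in> L \<Longrightarrow> level x \<le> Suc (level y)"
  using level_relpow[of y] edgeD[of x y]
  by (intro level_le relpow_Suc_I2[of _ y]) (auto simp: adjacency_def)

lemma exists_parent:
  assumes "x \<in> V" "level x = Suc n"
  obtains y where "direct_successor L x0 y x" "level y = n"
proof -
  obtain y where y: "(x, y) \<in> adjacency L" "(y, x0) \<in> adjacency L ^^ n"
    using level_relpow[OF assms(1)] assms(2) relpow_Suc_D2 by metis
  then have e: "{x, y} \<in> L"
    by (simp add: adjacency_def)
  have "level y = n"
    using level_le[OF y(2)] level_edge_le[OF e] assms(2) by simp
  with e assms show ?thesis
    by (intro that[of y]) (auto simp: direct_successor_def insert_commute)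
qed

text \<open>A vertex with two parents, or an edge inside a level, closes such a path to a cycle.\<close>
lemma same_level_path:
  assumes "x \<in> V" "y \<in> V" "x \<noteq> y" "level x = n" "level y = n"
  shows "\<exists>p. 3 \<le> length p \<and> distinct p \<and> successively (\<lambda>x y. {x, y} \<in> L) p \<and>
    hd p = x \<and> last p = y \<and> (\<forall>z\<in>set p. level z \<le> n)"
  using assms
proof (induction n arbitrary: x y)
  case 0
  \<comment> \<open>Vacuous: the root is the only vertex at level 0.\<close>
  then show ?case
    using level_eq_0_iff by metis
next
  case (Suc n)
  obtain x' where x': "direct_successor L x0 x' x" "level x' = n"
    using exists_parent Suc.prems by metis
  obtain y' where y': "direct_successor L x0 y' y" "level y' = n"
    using exists_parent Suc.prems by metis
  have e: "{x', x} \<in> L" "{x, x'} \<in> L" "{y', y} \<in> L"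
    using x' y' by (auto simp: direct_successor_def insert_commute)
  show ?case
  proof (cases "x' = y'")
    case True
    then show ?thesis
      using e Suc.prems x' y' by (intro exI[of _ "[x, x', y]"]) auto
  next
    case False
    then obtain p where p: "3 \<le> length p" "distinct p" "successively (\<lambda>x y. {x, y} \<in> L) p"
        "hd p = x'" "last p = y'" "\<forall>z\<in>set p. level z \<le> n"
      using Suc.IH[of x' y'] e edgeD x' y' by metis
    \<comment> \<open>The path stays at levels up to n while \<open>x\<close> and \<open>y\<close>
      lie at level n + 1, so attaching them at its ends keeps the vertices distinct.\<close>
    then have "x \<notin> set p" "y \<notin> set p" "p \<noteq> []"
      using Suc.prems by fastforce+
    then show ?thesis
      using p e Suc.prems
      by (intro exI[of _ "x # p @ [y]"]) (auto simp: successively_append_iff successively_Cons)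
  qed
qed

lemma parent_unique:
  assumes "direct_successor L x0 x z" "direct_successor L x0 y z"
  shows "x = y"
proof (rule ccontr)
  assume "x \<noteq> y"
  moreover have e: "{x, z} \<in> L" "{y, z} \<in> L" "{z, x} \<in> L" "level z = Suc (level x)" "level y = level x"
    using assms by (auto simp: direct_successor_def insert_commute)
  ultimately obtain p where p: "3 \<le> length p" "distinct p" "successively (\<lambda>x y. {x, y} \<in> L) p"
      "hd p = x" "last p = y" "\<forall>z\<in>set p. level z \<le> level x"
    using same_level_path[of x y "level x"] edgeD by metis
  then have "z \<notin> set p"
    using e by fastforce
  with p e have "graph_cycle L (z # p)"
    by (auto simp: graph_cycle_def successively_Cons)
  then show False
    using no_graph_cycle by blast
qed

lemma edge_levels_neq:
  assumes "{x, y} \<in> L"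
  shows "level x \<noteq> level y"
proof
  assume "level x = level y"
  then obtain p where p: "3 \<le> length p" "distinct p" "successively (\<lambda>x y. {x, y} \<in> L) p"
      "hd p = x" "last p = y"
    using same_level_path[of x y "level x"] edgeD[OF assms] by metis
  then have "graph_cycle L p"
    using assms by (auto simp: graph_cycle_def insert_commute)
  then show False
    using no_graph_cycle by blast
qed

lemma edge_cases:
  assumes "{x, y} \<in> L"
  shows "direct_successor L x0 x y \<or> direct_successor L x0 y x"
  using edge_levels_neq[OF assms] level_edge_le[of x y] level_edge_le[of y x] assms
  by (auto simp: direct_successor_def insert_commute)

section \<open>Numbers of children\<close>

lemma card_neighbours:
  assumes "x \<in> V"
  shows "card {y. {x, y} \<in> L} = k + 1"
proof -
  have "bij_betw (\<lambda>y. {x, y}) {y. {x, y} \<in> L} {e \<in> L. x \<in> e}"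
  proof (rule bij_betwI')
    fix e assume "e \<in> {e \<in> L. x \<in> e}"
    moreover obtain a b where "e = {a, b}"
      using calculation cayley unfolding cayley_tree_def is_tree_def simple_graph_def by blast
    ultimately show "\<exists>y\<in>{y. {x, y} \<in> L}. e = {x, y}"
      by (auto simp: insert_commute)
  qed (auto simp: doubleton_eq_iff)
  then show ?thesis
    using cayley assms by (simp add: bij_betw_same_card cayley_tree_def)
qed

lemma neighbours_root: "{y. {x0, y} \<in> L} = children x0"
  using edge_cases[of x0] by (auto simp: children_def direct_successor_def)

lemma neighbours_parent:
  assumes "direct_successor L x0 z x"
  shows "{y. {x, y} \<in> L} = insert z (children x)" "z \<notin> children x"
proof -
  have "y = z \<or> y \<in> children x" if "{x, y} \<in> L" for y
    using edge_cases[OF that] parent_unique[OF assms] by (auto simp: children_def)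
  then show "{y. {x, y} \<in> L} = insert z (children x)"
    using assms by (auto simp: children_def direct_successor_def insert_commute)
  show "z \<notin> children x"
    using assms by (auto simp: children_def direct_successor_def)
qed

lemma finite_children: "x \<in> V \<Longrightarrow> finite (children x)"
proof -
  assume "x \<in> V"
  \<comment> \<open>An infinite set has cardinality 0 by convention, which the value k + 1
    excludes.\<close>
  then have "finite {y. {x, y} \<in> L}"
    using card_neighbours[of x] by (metis add_is_0 card.infinite one_neq_zero)
  then show ?thesis
    by (rule finite_subset[rotated]) (auto simp: children_def direct_successor_def)
qed

lemma card_children_root: "card (children x0) = k + 1"
  using card_neighbours[OF root] neighbours_root by simp

lemma card_children:
  assumes "x \<in> V" "x \<noteq> x0"
  shows "card (children x) = k"
proof -
  obtain n where "level x = Suc n"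
    using level_eq_0_iff assms not0_implies_Suc by metis
  then obtain z where z: "direct_successor L x0 z x"
    using exists_parent assms by metis
  show ?thesis
    using card_neighbours[OF assms(1)] neighbours_parent[OF z] finite_children[OF assms(1)] by simp
qed

section \<open>Decomposition of balls, spheres and edge sets by levels\<close>

lemma sphere_0: "sphere 0 = {x0}"
  using level_eq_0_iff root by (auto simp: sphere_W_def)

lemma sphere_Suc: "sphere (Suc n) = (\<Union>x\<in>sphere n. children x)"
proof (intro Set.set_eqI iffI)
  fix y assume "y \<in> sphere (Suc n)"
  then obtain x where "direct_successor L x0 x y" "level x = n"
    using exists_parent by (auto simp: sphere_W_def)
  then show "y \<in> (\<Union>x\<in>sphere n. children x)"
    using edgeD by (auto simp: sphere_W_def children_def direct_successor_def)
qed (use edgeD in \<open>auto simp: sphere_W_def children_def direct_successor_def\<close>)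

lemma disjoint_children: "x \<noteq> y \<Longrightarrow> children x \<inter> children y = {}"
  using parent_unique by (auto simp: children_def)

lemma sphere_subset: "sphere n \<subseteq> V"
  by (auto simp: sphere_W_def)

lemma finite_sphere: "finite (sphere n)"
proof (induction n)
  case (Suc n)
  then show ?case
    using finite_children sphere_subset by (auto simp: sphere_Suc)
qed (simp add: sphere_0)

lemma ball_0: "ball 0 = {x0}"
  using level_eq_0_iff root by (auto simp: ball_V_def)

lemma ball_Suc: "ball (Suc n) = ball n \<union> sphere (Suc n)"
  by (auto simp: ball_V_def sphere_W_def)

lemma ball_sphere_disjoint: "ball n \<inter> sphere (Suc n) = {}"
  by (auto simp: ball_V_def sphere_W_def)

lemma sphere_subset_ball: "sphere n \<subseteq> ball n"
  by (auto simp: ball_V_def sphere_W_def)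

lemma finite_ball: "finite (ball n)"
  by (induction n) (simp_all add: ball_0 ball_Suc finite_sphere)

lemma ball_mono: "m \<le> n \<Longrightarrow> ball m \<subseteq> ball n"
  by (auto simp: ball_V_def)

lemma ball_subset: "ball n \<subseteq> V"
  by (auto simp: ball_V_def)

lemma finite_subset_ball:
  assumes "finite J" "J \<subseteq> V"
  shows "\<exists>n. J \<subseteq> ball n"
  using assms by (auto simp: ball_V_def subset_iff intro!: exI[of _ "Max (level ` J)"])

lemma finite_edges_up_to: "finite (edges_up_to n)"
  by (rule finite_subset[of _ "ball n \<times> ball n"]) (auto simp: edges_up_to_def finite_ball)

lemma edges_up_to_0: "edges_up_to 0 = {}"
  by (auto simp: edges_up_to_def ball_0 direct_successor_def)

lemma edges_up_to_Suc: "edges_up_to (Suc n) = edges_up_to n \<union> Sigma (sphere n) children"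
  using edgeD
  by (auto simp: edges_up_to_def ball_V_def sphere_W_def children_def direct_successor_def)

lemma edges_up_to_disjoint: "edges_up_to n \<inter> Sigma (sphere n) children = {}"
  by (auto simp: edges_up_to_def ball_V_def sphere_W_def children_def direct_successor_def)

lemma prod_sphere_Suc:
  "(\<Prod>y\<in>sphere (Suc n). f y) = (\<Prod>x\<in>sphere n. \<Prod>y\<in>children x. f y)"
  unfolding sphere_Suc
  by (rule prod.UNION_disjoint)
    (use finite_sphere finite_children sphere_subset disjoint_children in auto)

end

section \<open>Compatible boundary fields\<close>

lemma product_sigma_finite_unit_lebesgue: "product_sigma_finite (\<lambda>_ :: 'v. unit_lebesgue)"
  by (intro product_sigma_finite.intro prob_space_imp_sigma_finite prob_space_unit_lebesgue)

text \<open>The boundary equation is imposed edge by edge: integrating out a single child gives the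
  k-th root of the parent's field. It is also required at the root, where \<open>\<phi> x0\<close>
  is no boundary field of any level n >= 1 but describes the root spin.\<close>

locale tree_kernel = rooted_cayley_tree k V L x0
  for k and V :: "'v set" and L x0 +
  fixes K :: "real \<Rightarrow> real \<Rightarrow> real" and \<phi> :: "'v \<Rightarrow> real \<Rightarrow> real"
  assumes k_pos: "0 < k"
    and K_continuous: "continuous_on UNIV (\<lambda>p. K (fst p) (snd p))"
    and K_pos: "\<And>s t. s \<in> {0..1} \<Longrightarrow> t \<in> {0..1} \<Longrightarrow> 0 < K s t"
    and \<phi>_continuous: "\<And>x. continuous_on UNIV (\<phi> x)"
    and \<phi>_pos: "\<And>x t. t \<in> {0..1} \<Longrightarrow> 0 < \<phi> x t"
    and K_\<phi>: "\<And>x y s. direct_successor L x0 x y \<Longrightarrow> s \<in> {0..1} \<Longrightarrow>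
      (\<integral>\<^sup>+t. ennreal (K s t * \<phi> y t) \<partial>unit_lebesgue) = ennreal (root k (\<phi> x s))"
begin

interpretation product_sigma_finite "\<lambda>_ :: 'v. unit_lebesgue"
  by (rule product_sigma_finite_unit_lebesgue)

definition interaction :: "nat \<Rightarrow> ('v \<Rightarrow> real) \<Rightarrow> real" where
  "interaction n \<sigma> = (\<Prod>(x, y)\<in>edges_up_to n. K (\<sigma> x) (\<sigma> y))"

definition weight :: "nat \<Rightarrow> ('v \<Rightarrow> real) \<Rightarrow> real" where
  "weight n \<sigma> = interaction n \<sigma> * (\<Prod>x\<in>sphere n. \<phi> x (\<sigma> x))"

text \<open>The weight at level \<open>n + 1\<close> after integrating out the outermost spins.\<close>
definition integrated_weight :: "nat \<Rightarrow> ('v \<Rightarrow> real) \<Rightarrow> real" where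
  "integrated_weight n \<sigma> = interaction n \<sigma> * (\<Prod>x\<in>sphere n. root k (\<phi> x (\<sigma> x)) ^ card (children x))"

lemma \<phi>_measurable [measurable]: "\<phi> x \<in> borel_measurable borel"
  using \<phi>_continuous by (rule borel_measurable_continuous_onI)

lemma K_measurable_pair: "(\<lambda>p. K (fst p) (snd p)) \<in> borel_measurable (borel \<Otimes>\<^sub>M borel)"
  unfolding borel_prod by (rule borel_measurable_continuous_onI[OF K_continuous])

lemma K_measurable:
  assumes "f \<in> borel_measurable M" "g \<in> borel_measurable M"
  shows "(\<lambda>x. K (f x) (g x)) \<in> borel_measurable M"
  using measurable_compose[OF measurable_Pair[OF assms] K_measurable_pair] by (simp only: fst_conv snd_conv)

lemma interaction_measurable: "interaction n \<in> borel_measurable (lambda_prod (ball n))"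
  unfolding interaction_def [abs_def] split_beta
proof (rule borel_measurable_prod)
  fix e assume "e \<in> edges_up_to n"
  then have "fst e \<in> ball n" "snd e \<in> ball n"
    by (auto simp: edges_up_to_def)
  then show "(\<lambda>\<sigma>. K (\<sigma> (fst e)) (\<sigma> (snd e))) \<in> borel_measurable (lambda_prod (ball n))"
    by (intro K_measurable borel_measurable_lambda_prod_component)
qed

lemma weight_measurable: "weight n \<in> borel_measurable (lambda_prod (ball n))"
  unfolding weight_def [abs_def]
  by (intro borel_measurable_times interaction_measurable borel_measurable_prod
      measurable_compose[OF borel_measurable_lambda_prod_component \<phi>_measurable])
    (use sphere_subset_ball in auto)

lemma interaction_pos: "\<sigma> \<in> ball n \<rightarrow>\<^sub>E {0..1} \<Longrightarrow> 0 < interaction n \<sigma>"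
  unfolding interaction_def
  by (rule prod_pos) (auto simp: edges_up_to_def intro!: K_pos dest: PiE_mem)

lemma weight_pos:
  assumes "\<sigma> \<in> ball n \<rightarrow>\<^sub>E {0..1}"
  shows "0 < weight n \<sigma>"
proof -
  have "0 < (\<Prod>x\<in>sphere n. \<phi> x (\<sigma> x))"
    using PiE_mem[OF assms] sphere_subset_ball by (intro prod_pos \<phi>_pos) blast
  then show ?thesis
    unfolding weight_def by (rule mult_pos_pos[OF interaction_pos[OF assms]])
qed

text \<open>Compatibility with the integral already carried out: a vertex other than the root has k
  children, so its k-th root is raised to the power k. Level 0 is excluded because the root has k +
  1 children.\<close>

lemma integrated_weight_eq_weight:
  assumes "\<sigma> \<in> ball (Suc n) \<rightarrow>\<^sub>E {0..1}"
  shows "integrated_weight (Suc n) \<sigma> = weight (Suc n) \<sigma>"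
proof -
  have "root k (\<phi> x (\<sigma> x)) ^ card (children x) = \<phi> x (\<sigma> x)" if x: "x \<in> sphere (Suc n)" for x
  proof -
    have "x \<in> V" "x \<noteq> x0"
      using x by (auto simp: sphere_W_def)
    moreover have "0 < \<phi> x (\<sigma> x)"
      using PiE_mem[OF assms] sphere_subset_ball x by (intro \<phi>_pos) blast
    ultimately show ?thesis
      using k_pos by (simp add: card_children)
  qed
  then show ?thesis
    by (simp add: integrated_weight_def weight_def)
qed

lemma integrated_weight_0: "integrated_weight 0 \<sigma> = root k (\<phi> x0 (\<sigma> x0)) ^ (k + 1)"
  by (simp add: integrated_weight_def interaction_def edges_up_to_0 sphere_0 card_children_root)

lemma interaction_Suc:
  "interaction (Suc n) \<sigma> = interaction n \<sigma> * (\<Prod>x\<in>sphere n. \<Prod>y\<in>children x. K (\<sigma> x) (\<sigma> y))"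
proof -
  have fin: "finite (Sigma (sphere n) children)"
    using finite_children sphere_subset by (intro finite_SigmaI finite_sphere) blast
  have "interaction (Suc n) \<sigma> = interaction n \<sigma> * (\<Prod>(x, y)\<in>Sigma (sphere n) children. K (\<sigma> x) (\<sigma> y))"
    unfolding interaction_def edges_up_to_Suc
    by (rule prod.union_disjoint[OF finite_edges_up_to fin edges_up_to_disjoint])
  also have "(\<Prod>(x, y)\<in>Sigma (sphere n) children. K (\<sigma> x) (\<sigma> y)) = (\<Prod>x\<in>sphere n. \<Prod>y\<in>children x. K (\<sigma> x) (\<sigma> y))"
    using finite_children sphere_subset by (intro prod.Sigma[symmetric] finite_sphere) blast
  finally show ?thesis .
qed

lemma interaction_cong: "(\<And>x. x \<in> ball n \<Longrightarrow> \<sigma> x = \<tau> x) \<Longrightarrow> interaction n \<sigma> = interaction n \<tau>"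
  unfolding interaction_def by (rule prod.cong) (auto simp: edges_up_to_def)

text \<open>Turns the double product over vertices and their children into a single product over the
  outer sphere, the form to which the integral of a product over independent coordinates
  applies.\<close>

definition parent :: "'v \<Rightarrow> 'v" where
  "parent y = (THE x. direct_successor L x0 x y)"

lemma parent_eq: "y \<in> children x \<Longrightarrow> parent y = x"
  unfolding parent_def children_def using parent_unique by blast

lemma weight_merge:
  "weight (Suc n) (merge (ball n) (sphere (Suc n)) (\<sigma>, \<omega>)) =
    interaction n \<sigma> * (\<Prod>y\<in>sphere (Suc n). K (\<sigma> (parent y)) (\<omega> y) * \<phi> y (\<omega> y))"
proof -
  let ?\<rho> = "merge (ball n) (sphere (Suc n)) (\<sigma>, \<omega>)"
  note disj = ball_sphere_disjoint[of n]
  have old: "?\<rho> x = \<sigma> x" if "x \<in> ball n" for x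
    using that disj by simp
  have new: "?\<rho> y = \<omega> y" if "y \<in> sphere (Suc n)" for y
    using that disj by simp
  have "interaction n ?\<rho> = interaction n \<sigma>"
    by (rule interaction_cong) (rule old)
  moreover have "(\<Prod>x\<in>sphere n. \<Prod>y\<in>children x. K (?\<rho> x) (?\<rho> y))
      = (\<Prod>x\<in>sphere n. \<Prod>y\<in>children x. K (\<sigma> (parent y)) (\<omega> y))"
  proof (intro prod.cong refl)
    fix x y assume xy: "x \<in> sphere n" "y \<in> children x"
    then have "y \<in> sphere (Suc n)"
      by (auto simp: sphere_Suc)
    with xy show "K (?\<rho> x) (?\<rho> y) = K (\<sigma> (parent y)) (\<omega> y)"
      using old[of x] new[of y] sphere_subset_ball[of n] parent_eq[of y x] by auto
  qed
  moreover have "(\<Prod>y\<in>sphere (Suc n). \<phi> y (?\<rho> y)) = (\<Prod>y\<in>sphere (Suc n). \<phi> y (\<omega> y))"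
    by (intro prod.cong refl) (simp only: new)
  ultimately show ?thesis
    unfolding weight_def interaction_Suc by (simp add: prod_sphere_Suc[symmetric] prod.distrib)
qed

lemma weight_merge_measurable:
  assumes "\<sigma> \<in> ball n \<rightarrow>\<^sub>E {0..1}"
  shows "(\<lambda>\<omega>. weight (Suc n) (merge (ball n) (sphere (Suc n)) (\<sigma>, \<omega>))) \<in> borel_measurable (lambda_prod (sphere (Suc n)))"
proof -
  let ?M = "\<lambda>B. PiM B (\<lambda>_ :: 'v. unit_lebesgue)"
  have "\<sigma> \<in> space (?M (ball n))"
    using assms by (simp only: space_lambda_prod[unfolded lambda_prod_def])
  then have "(\<lambda>\<omega>. merge (ball n) (sphere (Suc n)) (\<sigma>, \<omega>)) \<in> measurable (?M (sphere (Suc n))) (?M (ball n \<union> sphere (Suc n)))"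
    by (intro measurable_compose[OF measurable_Pair1' measurable_merge])
  then show ?thesis
    using weight_measurable[of "Suc n"] unfolding lambda_prod_def ball_Suc by (rule measurable_compose)
qed

text \<open>With the inner spins fixed, the integrand has one factor per outer vertex, so the
  integral splits into one-dimensional ones, each evaluated by \<open>K_\<phi>\<close>.\<close>

lemma nn_integral_weight_merge:
  assumes \<sigma>: "\<sigma> \<in> ball n \<rightarrow>\<^sub>E {0..1}"
  shows "(\<integral>\<^sup>+\<omega>. ennreal (weight (Suc n) (merge (ball n) (sphere (Suc n)) (\<sigma>, \<omega>))) \<partial>lambda_prod (sphere (Suc n)))
    = ennreal (integrated_weight n \<sigma>)"
proof -
  have parent: "\<sigma> (parent y) \<in> {0..1}" if y: "y \<in> sphere (Suc n)" for y
  proof -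
    obtain x where "x \<in> sphere n" "y \<in> children x"
      using y by (auto simp: sphere_Suc)
    then show ?thesis
      using PiE_mem[OF \<sigma>, of x] sphere_subset_ball[of n] parent_eq[of y x] by auto
  qed
  have nonneg: "0 \<le> K (\<sigma> (parent y)) t * \<phi> y t" if "y \<in> sphere (Suc n)" "t \<in> {0..1}" for y t
    using K_pos[OF parent[OF that(1)] that(2)] \<phi>_pos[OF that(2), of y] by simp
  have "(\<integral>\<^sup>+\<omega>. ennreal (weight (Suc n) (merge (ball n) (sphere (Suc n)) (\<sigma>, \<omega>))) \<partial>lambda_prod (sphere (Suc n)))
      = (\<integral>\<^sup>+\<omega>. ennreal (interaction n \<sigma>) *
          (\<Prod>y\<in>sphere (Suc n). ennreal (K (\<sigma> (parent y)) (\<omega> y) * \<phi> y (\<omega> y))) \<partial>lambda_prod (sphere (Suc n)))"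
  proof (rule nn_integral_cong)
    fix \<omega> :: "'v \<Rightarrow> real" assume "\<omega> \<in> space (lambda_prod (sphere (Suc n)))"
    then have \<omega>: "\<omega> y \<in> {0..1}" if "y \<in> sphere (Suc n)" for y
      using that unfolding space_lambda_prod by (rule PiE_mem)
    have n: "0 \<le> K (\<sigma> (parent y)) (\<omega> y) * \<phi> y (\<omega> y)" if "y \<in> sphere (Suc n)" for y
      by (rule nonneg[OF that \<omega>[OF that]])
    have p: "(\<Prod>y\<in>sphere (Suc n). ennreal (K (\<sigma> (parent y)) (\<omega> y) * \<phi> y (\<omega> y)))
        = ennreal (\<Prod>y\<in>sphere (Suc n). K (\<sigma> (parent y)) (\<omega> y) * \<phi> y (\<omega> y))"
      by (rule prod_ennreal) (rule n)
    show "ennreal (weight (Suc n) (merge (ball n) (sphere (Suc n)) (\<sigma>, \<omega>))) = ennreal (interaction n \<sigma>) *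
        (\<Prod>y\<in>sphere (Suc n). ennreal (K (\<sigma> (parent y)) (\<omega> y) * \<phi> y (\<omega> y)))"
      unfolding weight_merge p
      by (rule ennreal_mult) (simp_all add: n prod_nonneg interaction_pos[OF \<sigma>] less_imp_le)
  qed
  also have "\<dots> = ennreal (interaction n \<sigma>) * (\<integral>\<^sup>+\<omega>.
      (\<Prod>y\<in>sphere (Suc n). ennreal (K (\<sigma> (parent y)) (\<omega> y) * \<phi> y (\<omega> y))) \<partial>lambda_prod (sphere (Suc n)))"
    by (intro nn_integral_cmult borel_measurable_prod_ennreal measurable_compose[OF _ measurable_ennreal]
        borel_measurable_times K_measurable measurable_const
        borel_measurable_lambda_prod_component measurable_compose[OF borel_measurable_lambda_prod_component \<phi>_measurable])
      (simp_all only: space_borel UNIV_I)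
  also have "(\<integral>\<^sup>+\<omega>. (\<Prod>y\<in>sphere (Suc n). ennreal (K (\<sigma> (parent y)) (\<omega> y) * \<phi> y (\<omega> y))) \<partial>lambda_prod (sphere (Suc n)))
      = (\<Prod>y\<in>sphere (Suc n). \<integral>\<^sup>+t. ennreal (K (\<sigma> (parent y)) t * \<phi> y t) \<partial>unit_lebesgue)"
    unfolding lambda_prod_def
    by (intro product_nn_integral_prod finite_sphere measurable_compose[OF _ measurable_ennreal]
        borel_measurable_times K_measurable measurable_const measurable_unit_lebesgue \<phi>_measurable measurable_ident_sets)
      (simp_all only: space_borel UNIV_I)
  also have "\<dots> = (\<Prod>y\<in>sphere (Suc n). ennreal (root k (\<phi> (parent y) (\<sigma> (parent y)))))"
  proof (intro prod.cong refl)
    fix y assume y: "y \<in> sphere (Suc n)"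
    then obtain x where "x \<in> sphere n" "y \<in> children x"
      by (auto simp: sphere_Suc)
    then have "direct_successor L x0 (parent y) y"
      using parent_eq[of y x] by (simp add: children_def)
    then show "(\<integral>\<^sup>+t. ennreal (K (\<sigma> (parent y)) t * \<phi> y t) \<partial>unit_lebesgue) = ennreal (root k (\<phi> (parent y) (\<sigma> (parent y))))"
      using parent[OF y] by (rule K_\<phi>)
  qed
  also have "\<dots> = ennreal (\<Prod>y\<in>sphere (Suc n). root k (\<phi> (parent y) (\<sigma> (parent y))))"
    using \<phi>_pos[OF parent] k_pos by (intro prod_ennreal) (simp add: less_imp_le)
  \<comment> \<open>Grouped by parent, all children of \<open>x\<close> contribute the same
    factor.\<close>
  also have "(\<Prod>y\<in>sphere (Suc n). root k (\<phi> (parent y) (\<sigma> (parent y))))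
      = (\<Prod>x\<in>sphere n. root k (\<phi> x (\<sigma> x)) ^ card (children x))"
    unfolding prod_sphere_Suc by (intro prod.cong refl) (simp add: parent_eq)
  also have "ennreal (interaction n \<sigma>) * ennreal \<dots> = ennreal (integrated_weight n \<sigma>)"
    unfolding integrated_weight_def using interaction_pos[OF \<sigma>] by (intro ennreal_mult'[symmetric]) simp
  finally show ?thesis .
qed

text \<open>\<open>G\<close> is a test function of the inner spins: the constant 1 gives the total
  mass, an indicator gives the marginal on the inner ball.\<close>

lemma nn_integral_weight_Suc:
  assumes G: "G \<in> borel_measurable (lambda_prod (ball n))"
  shows "(\<integral>\<^sup>+\<sigma>. ennreal (weight (Suc n) \<sigma>) * G (restrict \<sigma> (ball n)) \<partial>lambda_prod (ball (Suc n)))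
    = (\<integral>\<^sup>+\<sigma>. ennreal (integrated_weight n \<sigma>) * G \<sigma> \<partial>lambda_prod (ball n))"
proof -
  let ?M = "\<lambda>B. PiM B (\<lambda>_ :: 'v. unit_lebesgue)"
  let ?m = "merge (ball n) (sphere (Suc n))"
  let ?f = "\<lambda>\<sigma>. ennreal (weight (Suc n) \<sigma>) * G (restrict \<sigma> (ball n))"
  have f: "?f \<in> borel_measurable (?M (ball n \<union> sphere (Suc n)))"
    unfolding ball_Suc[symmetric] lambda_prod_def[symmetric]
    by (rule borel_measurable_times_ennreal[OF measurable_compose[OF weight_measurable measurable_ennreal]
          measurable_compose[OF measurable_lambda_prod_restrict[OF ball_mono] G]]) simp
  have "(\<integral>\<^sup>+\<sigma>. ?f \<sigma> \<partial>lambda_prod (ball (Suc n))) = (\<integral>\<^sup>+\<sigma>. \<integral>\<^sup>+\<omega>. ?f (?m (\<sigma>, \<omega>)) \<partial>lambda_prod (sphere (Suc n)) \<partial>lambda_prod (ball n))"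
    unfolding lambda_prod_def ball_Suc
    by (rule product_nn_integral_fold[OF ball_sphere_disjoint finite_ball finite_sphere f])
  also have "\<dots> = (\<integral>\<^sup>+\<sigma>. ennreal (integrated_weight n \<sigma>) * G \<sigma> \<partial>lambda_prod (ball n))"
  proof (rule nn_integral_cong)
    fix \<sigma> assume \<sigma>: "\<sigma> \<in> space (lambda_prod (ball n))"
    then have \<sigma>': "\<sigma> \<in> ball n \<rightarrow>\<^sub>E {0..1}"
      by (simp only: space_lambda_prod)
    \<comment> \<open>Restricting the merged configuration returns the inner one, so
      \<open>G\<close> is constant in the inner integral and can be pulled out.\<close>
    have restr: "restrict (?m (\<sigma>, \<omega>)) (ball n) = \<sigma>" for \<omega>
      using PiE_restrict[OF \<sigma>'] ball_sphere_disjoint[of n] by (simp only: restrict_merge)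
    have "(\<integral>\<^sup>+\<omega>. ?f (?m (\<sigma>, \<omega>)) \<partial>lambda_prod (sphere (Suc n)))
        = (\<integral>\<^sup>+\<omega>. ennreal (weight (Suc n) (?m (\<sigma>, \<omega>))) \<partial>lambda_prod (sphere (Suc n))) * G \<sigma>"
      unfolding restr
      by (rule nn_integral_multc[OF measurable_compose[OF weight_merge_measurable[OF \<sigma>'] measurable_ennreal]])
    then show "(\<integral>\<^sup>+\<omega>. ?f (?m (\<sigma>, \<omega>)) \<partial>lambda_prod (sphere (Suc n))) = ennreal (integrated_weight n \<sigma>) * G \<sigma>"
      by (simp only: nn_integral_weight_merge[OF \<sigma>'])
  qed
  finally show ?thesis .
qed

text \<open>The normalising constant of every level n >= 1: integrating out all spins but the one at
  the root leaves this one-dimensional integral.\<close>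

definition Z :: real where
  "Z = enn2real (\<integral>\<^sup>+t. ennreal (root k (\<phi> x0 t) ^ (k + 1)) \<partial>unit_lebesgue)"

lemma root_density_measurable: "(\<lambda>t. ennreal (root k (\<phi> x0 t) ^ (k + 1))) \<in> borel_measurable borel"
  by (intro measurable_compose[OF _ measurable_ennreal] borel_measurable_continuous_onI
      continuous_on_power continuous_on_real_root \<phi>_continuous)

lemma root_marginal:
  assumes "A \<in> sets unit_lebesgue"
  shows "(\<integral>\<^sup>+\<sigma>. ennreal (weight (Suc 0) \<sigma>) * indicator A (\<sigma> x0) \<partial>lambda_prod (ball (Suc 0)))
    = (\<integral>\<^sup>+t. ennreal (root k (\<phi> x0 t) ^ (k + 1)) * indicator A t \<partial>unit_lebesgue)"
proof -
  have root_ball_0: "x0 \<in> ball 0"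
    by (simp add: ball_0)
  then have "(\<lambda>\<sigma>. \<sigma> x0) \<in> measurable (lambda_prod (ball 0)) unit_lebesgue"
    by (rule measurable_lambda_prod_component)
  then have G: "(\<lambda>\<sigma>. indicator A (\<sigma> x0) :: ennreal) \<in> borel_measurable (lambda_prod (ball 0))"
    using borel_measurable_indicator[OF assms] by (rule measurable_compose)
  have "(\<integral>\<^sup>+\<sigma>. ennreal (weight (Suc 0) \<sigma>) * indicator A (\<sigma> x0) \<partial>lambda_prod (ball (Suc 0)))
      = (\<integral>\<^sup>+\<sigma>. ennreal (integrated_weight 0 \<sigma>) * indicator A (\<sigma> x0) \<partial>lambda_prod (ball 0))"
    using nn_integral_weight_Suc[OF G] by (simp only: restrict_apply' root_ball_0)
  also have "\<dots> = (\<integral>\<^sup>+t. ennreal (root k (\<phi> x0 t) ^ (k + 1)) * indicator A t \<partial>unit_lebesgue)"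
    unfolding integrated_weight_0 lambda_prod_def ball_0
    by (rule product_nn_integral_singleton[where f = "\<lambda>t. ennreal (root k (\<phi> x0 t) ^ (k + 1)) * indicator A t"])
      (intro borel_measurable_times_ennreal measurable_unit_lebesgue root_density_measurable borel_measurable_indicator assms)
  finally show ?thesis .
qed

lemma root_integral:
  shows "(\<integral>\<^sup>+t. ennreal (root k (\<phi> x0 t) ^ (k + 1)) \<partial>unit_lebesgue) = ennreal Z" "0 < Z"
proof -
  let ?r = "\<lambda>t. root k (\<phi> x0 t) ^ (k + 1)"
  have cont: "continuous_on {0..1} ?r"
    by (intro continuous_on_power continuous_on_real_root continuous_on_subset[OF \<phi>_continuous]) simp
  have meas: "?r \<in> borel_measurable borel"
    by (intro borel_measurable_continuous_onI continuous_on_power continuous_on_real_root \<phi>_continuous)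
  have pos: "0 < ?r t" if "t \<in> {0..1}" for t
    using \<phi>_pos[OF that, of x0] k_pos by (intro zero_less_power) simp
  have int: "(?r has_integral integral {0..1} ?r) {0..1}"
    using integrable_continuous_real[OF cont] by (rule integrable_integral)
  have "(\<integral>\<^sup>+t. ennreal (?r t) \<partial>unit_lebesgue) = ennreal (integral {0..1} ?r)"
    using pos by (intro nn_integral_unit_lebesgue[OF meas int]) (rule less_imp_le)
  moreover have "0 < integral {0..1} ?r"
  proof -
    have "0 \<le> integral {0..1} ?r"
      using pos by (intro integral_nonneg integrable_continuous_real[OF cont]) (rule less_imp_le)
    \<comment> \<open>A nonnegative continuous function with integral zero vanishes identically,
      against positivity at 0.\<close>
    moreover have "integral {0..1} ?r \<noteq> 0"
    proof
      assume "integral {0..1} ?r = 0"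
      then have "\<forall>t\<in>{0..1}. ?r t = 0"
        using pos by (subst (asm) integral_eq_0_iff[OF cont]) (auto intro: less_imp_le)
      then show False
        using pos[of 0] by (metis atLeastAtMost_iff less_irrefl order_refl zero_le_one)
    qed
    ultimately show ?thesis
      by simp
  qed
  ultimately show "(\<integral>\<^sup>+t. ennreal (?r t) \<partial>unit_lebesgue) = ennreal Z" "0 < Z"
    by (simp_all add: Z_def)
qed

lemma nn_integral_weight:
  "(\<integral>\<^sup>+\<sigma>. ennreal (weight (Suc n) \<sigma>) \<partial>lambda_prod (ball (Suc n))) = ennreal Z"
proof (induction n)
  case 0
  have x0: "x0 \<in> ball (Suc 0)"
    using root by (simp add: ball_V_def)
  have "(\<integral>\<^sup>+\<sigma>. ennreal (weight (Suc 0) \<sigma>) \<partial>lambda_prod (ball (Suc 0)))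
      = (\<integral>\<^sup>+\<sigma>. ennreal (weight (Suc 0) \<sigma>) * indicator {0..1} (\<sigma> x0) \<partial>lambda_prod (ball (Suc 0)))"
  proof (rule nn_integral_cong)
    fix \<sigma> :: "'v \<Rightarrow> real" assume "\<sigma> \<in> space (lambda_prod (ball (Suc 0)))"
    then have "\<sigma> x0 \<in> {0..1}"
      unfolding space_lambda_prod by (rule PiE_mem[OF _ x0])
    then show "ennreal (weight (Suc 0) \<sigma>) = ennreal (weight (Suc 0) \<sigma>) * indicator {0..1} (\<sigma> x0)"
      by (simp only: indicator_simps mult_1_right)
  qed
  also have "\<dots> = (\<integral>\<^sup>+t. ennreal (root k (\<phi> x0 t) ^ (k + 1)) * indicator {0..1} t \<partial>unit_lebesgue)"
    by (rule root_marginal) (metis sets.top space_unit_lebesgue)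
  also have "\<dots> = (\<integral>\<^sup>+t. ennreal (root k (\<phi> x0 t) ^ (k + 1)) \<partial>unit_lebesgue)"
    by (rule nn_integral_cong) (simp only: space_unit_lebesgue indicator_simps mult_1_right)
  finally show ?case
    by (simp only: root_integral)
next
  case (Suc n)
  have "(\<integral>\<^sup>+\<sigma>. ennreal (weight (Suc (Suc n)) \<sigma>) \<partial>lambda_prod (ball (Suc (Suc n))))
      = (\<integral>\<^sup>+\<sigma>. ennreal (integrated_weight (Suc n) \<sigma>) \<partial>lambda_prod (ball (Suc n)))"
    using nn_integral_weight_Suc[of "\<lambda>_. 1" "Suc n", OF borel_measurable_const] by (simp only: mult_1_right)
  also have "\<dots> = (\<integral>\<^sup>+\<sigma>. ennreal (weight (Suc n) \<sigma>) \<partial>lambda_prod (ball (Suc n)))"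
    by (rule nn_integral_cong) (simp only: space_lambda_prod integrated_weight_eq_weight)
  finally show ?case
    by (simp only: Suc.IH)
qed

text \<open>The Gibbs measure of level n in product form, free of \<open>H\<close> and
  \<open>h\<close>. The constant \<open>Z\<close> normalises it for n >= 1.\<close>

definition level_measure :: "nat \<Rightarrow> ('v \<Rightarrow> real) measure" where
  "level_measure n = density (lambda_prod (ball n)) (\<lambda>\<sigma>. ennreal (inverse Z * weight n \<sigma>))"

lemma ennreal_scale_Z: "ennreal (inverse Z * a) = ennreal (inverse Z) * ennreal a"
  using root_integral(2) by (intro ennreal_mult') simp

lemma ennreal_inverse_Z: "ennreal (inverse Z) * ennreal Z = 1"
  using root_integral(2) by (simp flip: ennreal_mult')

lemma sets_level_measure: "sets (level_measure n) = sets (lambda_prod (ball n))"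
  unfolding level_measure_def by (rule sets_density)

lemma emeasure_level_measure:
  assumes X: "X \<in> sets (lambda_prod (ball n))"
  shows "emeasure (level_measure n) X =
    ennreal (inverse Z) * (\<integral>\<^sup>+\<sigma>. ennreal (weight n \<sigma>) * indicator X \<sigma> \<partial>lambda_prod (ball n))"
proof -
  note w = measurable_compose[OF weight_measurable measurable_ennreal]
  have "emeasure (level_measure n) X =
      (\<integral>\<^sup>+\<sigma>. ennreal (inverse Z) * ennreal (weight n \<sigma>) * indicator X \<sigma> \<partial>lambda_prod (ball n))"
    unfolding level_measure_def ennreal_scale_Z
    by (intro emeasure_density borel_measurable_times_ennreal w X borel_measurable_const)
  also have "\<dots> = ennreal (inverse Z) * (\<integral>\<^sup>+\<sigma>. ennreal (weight n \<sigma>) * indicator X \<sigma> \<partial>lambda_prod (ball n))"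
    unfolding mult.assoc by (intro nn_integral_cmult borel_measurable_times_ennreal w borel_measurable_indicator X)
  finally show ?thesis .
qed

lemma prob_space_level_measure: "prob_space (level_measure (Suc n))"
proof (rule prob_spaceI)
  have sp: "space (level_measure (Suc n)) = space (lambda_prod (ball (Suc n)))"
    by (rule sets_eq_imp_space_eq[OF sets_level_measure])
  have "(\<integral>\<^sup>+\<sigma>. ennreal (weight (Suc n) \<sigma>) * indicator (space (lambda_prod (ball (Suc n)))) \<sigma> \<partial>lambda_prod (ball (Suc n)))
      = (\<integral>\<^sup>+\<sigma>. ennreal (weight (Suc n) \<sigma>) \<partial>lambda_prod (ball (Suc n)))"
    by (rule nn_integral_cong) (simp only: indicator_simps mult_1_right)
  then show "emeasure (level_measure (Suc n)) (space (level_measure (Suc n))) = 1"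
    unfolding sp emeasure_level_measure[OF sets.top] by (simp only: nn_integral_weight ennreal_inverse_Z)
qed

text \<open>Compatibility in terms of measures, the consistency needed for the extension: the test
  function is the indicator of \<open>X\<close>, and the integrated weight is again a weight because
  the inner level is at least 1.\<close>

lemma distr_level_measure:
  "distr (level_measure (Suc (Suc n))) (lambda_prod (ball (Suc n))) (\<lambda>\<sigma>. restrict \<sigma> (ball (Suc n))) = level_measure (Suc n)"
proof (rule measure_eqI)
  let ?r = "\<lambda>\<sigma> :: 'v \<Rightarrow> real. restrict \<sigma> (ball (Suc n))"
  fix X assume "X \<in> sets (distr (level_measure (Suc (Suc n))) (lambda_prod (ball (Suc n))) ?r)"
  then have X: "X \<in> sets (lambda_prod (ball (Suc n)))"
    by (simp only: sets_distr)
  have r: "?r \<in> measurable (lambda_prod (ball (Suc (Suc n)))) (lambda_prod (ball (Suc n)))"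
    by (rule measurable_lambda_prod_restrict[OF ball_mono]) simp
  then have r': "?r \<in> measurable (level_measure (Suc (Suc n))) (lambda_prod (ball (Suc n)))"
    by (simp only: measurable_cong_sets[OF sets_level_measure refl])
  have sp: "space (level_measure (Suc (Suc n))) = space (lambda_prod (ball (Suc (Suc n))))"
    by (rule sets_eq_imp_space_eq[OF sets_level_measure])
  have "emeasure (distr (level_measure (Suc (Suc n))) (lambda_prod (ball (Suc n))) ?r) X
      = ennreal (inverse Z) * (\<integral>\<^sup>+\<sigma>. ennreal (weight (Suc (Suc n)) \<sigma>) *
          indicator (?r -` X \<inter> space (lambda_prod (ball (Suc (Suc n))))) \<sigma> \<partial>lambda_prod (ball (Suc (Suc n))))"
    unfolding emeasure_distr[OF r' X] sp by (rule emeasure_level_measure[OF measurable_sets[OF r X]])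
  also have "(\<integral>\<^sup>+\<sigma>. ennreal (weight (Suc (Suc n)) \<sigma>) *
          indicator (?r -` X \<inter> space (lambda_prod (ball (Suc (Suc n))))) \<sigma> \<partial>lambda_prod (ball (Suc (Suc n))))
      = (\<integral>\<^sup>+\<sigma>. ennreal (weight (Suc (Suc n)) \<sigma>) * indicator X (?r \<sigma>) \<partial>lambda_prod (ball (Suc (Suc n))))"
    by (rule nn_integral_cong) (simp only: indicator_def Int_iff vimage_eq simp_thms)
  also have "\<dots> = (\<integral>\<^sup>+\<sigma>. ennreal (integrated_weight (Suc n) \<sigma>) * indicator X \<sigma> \<partial>lambda_prod (ball (Suc n)))"
    by (rule nn_integral_weight_Suc[OF borel_measurable_indicator[OF X]])
  also have "\<dots> = (\<integral>\<^sup>+\<sigma>. ennreal (weight (Suc n) \<sigma>) * indicator X \<sigma> \<partial>lambda_prod (ball (Suc n)))"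
    by (rule nn_integral_cong) (simp only: space_lambda_prod integrated_weight_eq_weight)
  finally show "emeasure (distr (level_measure (Suc (Suc n))) (lambda_prod (ball (Suc n))) ?r) X = emeasure (level_measure (Suc n)) X"
    by (simp only: emeasure_level_measure[OF X])
qed (simp only: sets_distr sets_level_measure)

lemma distr_level_measure_root:
  "distr (level_measure (Suc 0)) unit_lebesgue (\<lambda>\<sigma>. \<sigma> x0)
    = density unit_lebesgue (\<lambda>t. ennreal (inverse Z * root k (\<phi> x0 t) ^ (k + 1)))"
proof (rule measure_eqI)
  fix A assume "A \<in> sets (distr (level_measure (Suc 0)) unit_lebesgue (\<lambda>\<sigma>. \<sigma> x0))"
  then have A: "A \<in> sets unit_lebesgue"
    by (simp only: sets_distr)
  have x0: "x0 \<in> ball (Suc 0)"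
    using root by (simp add: ball_V_def)
  note r = measurable_lambda_prod_component[OF x0]
  have r': "(\<lambda>\<sigma>. \<sigma> x0) \<in> measurable (level_measure (Suc 0)) unit_lebesgue"
    using r by (simp only: measurable_cong_sets[OF sets_level_measure refl])
  have sp: "space (level_measure (Suc 0)) = space (lambda_prod (ball (Suc 0)))"
    by (rule sets_eq_imp_space_eq[OF sets_level_measure])
  have "emeasure (distr (level_measure (Suc 0)) unit_lebesgue (\<lambda>\<sigma>. \<sigma> x0)) A
      = ennreal (inverse Z) * (\<integral>\<^sup>+\<sigma>. ennreal (weight (Suc 0) \<sigma>) *
          indicator ((\<lambda>\<sigma>. \<sigma> x0) -` A \<inter> space (lambda_prod (ball (Suc 0)))) \<sigma> \<partial>lambda_prod (ball (Suc 0)))"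
    unfolding emeasure_distr[OF r' A] sp by (rule emeasure_level_measure[OF measurable_sets[OF r A]])
  also have "(\<integral>\<^sup>+\<sigma>. ennreal (weight (Suc 0) \<sigma>) *
          indicator ((\<lambda>\<sigma>. \<sigma> x0) -` A \<inter> space (lambda_prod (ball (Suc 0)))) \<sigma> \<partial>lambda_prod (ball (Suc 0)))
      = (\<integral>\<^sup>+\<sigma>. ennreal (weight (Suc 0) \<sigma>) * indicator A (\<sigma> x0) \<partial>lambda_prod (ball (Suc 0)))"
    by (rule nn_integral_cong) (simp only: indicator_def Int_iff vimage_eq simp_thms)
  also have "\<dots> = (\<integral>\<^sup>+t. ennreal (root k (\<phi> x0 t) ^ (k + 1)) * indicator A t \<partial>unit_lebesgue)"
    by (rule root_marginal[OF A])
  also have "ennreal (inverse Z) * \<dots> = (\<integral>\<^sup>+t. ennreal (inverse Z) * (ennreal (root k (\<phi> x0 t) ^ (k + 1)) * indicator A t) \<partial>unit_lebesgue)"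
    by (intro nn_integral_cmult[symmetric] borel_measurable_times_ennreal measurable_unit_lebesgue root_density_measurable borel_measurable_indicator A)
  also have "\<dots> = emeasure (density unit_lebesgue (\<lambda>t. ennreal (inverse Z) * ennreal (root k (\<phi> x0 t) ^ (k + 1)))) A"
    unfolding mult.assoc[symmetric]
    by (intro emeasure_density[symmetric] borel_measurable_times_ennreal measurable_unit_lebesgue root_density_measurable borel_measurable_const A)
  finally show "emeasure (distr (level_measure (Suc 0)) unit_lebesgue (\<lambda>\<sigma>. \<sigma> x0)) A
      = emeasure (density unit_lebesgue (\<lambda>t. ennreal (inverse Z * root k (\<phi> x0 t) ^ (k + 1)))) A"
    by (simp only: ennreal_scale_Z)
qed (simp only: sets_distr sets_density)

text \<open>The Hamiltonian and the field are tied to the product weights only on the cube, since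
  only there are the kernel and \<open>\<phi>\<close> known to be positive and the logarithms
  invertible.\<close>

context
  fixes \<beta> :: real and H :: "'v hamiltonian" and h :: "'v \<Rightarrow> real \<Rightarrow> real"
  assumes H: "\<And>n \<sigma>. \<sigma> \<in> ball n \<rightarrow>\<^sub>E {0..1} \<Longrightarrow> exp (- \<beta> * H (ball n) \<sigma>) = interaction n \<sigma>"
    and h: "\<And>x t. t \<in> {0..1} \<Longrightarrow> h x t = ln (\<phi> x t)"
begin

lemma gibbs_weight_eq:
  assumes \<sigma>: "\<sigma> \<in> ball n \<rightarrow>\<^sub>E {0..1}"
  shows "gibbs_weight V L x0 \<beta> H h n \<sigma> = weight n \<sigma>"
proof -
  have "exp (\<Sum>x\<in>sphere n. h x (\<sigma> x)) = (\<Prod>x\<in>sphere n. \<phi> x (\<sigma> x))"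
    unfolding exp_sum[OF finite_sphere]
  proof (intro prod.cong refl)
    fix x assume "x \<in> sphere n"
    then have "\<sigma> x \<in> {0..1}"
      using PiE_mem[OF \<sigma>] sphere_subset_ball by blast
    then show "exp (h x (\<sigma> x)) = \<phi> x (\<sigma> x)"
      using \<phi>_pos by (simp add: h)
  qed
  then show ?thesis
    by (simp only: gibbs_weight_def exp_add H[OF \<sigma>] weight_def)
qed

lemma gibbs_weight_measurable:
  "gibbs_weight V L x0 \<beta> H h n \<in> borel_measurable (lambda_prod (ball n))"
  using weight_measurable
  by (rule measurable_cong[THEN iffD1, rotated]) (simp only: space_lambda_prod gibbs_weight_eq)

lemma gibbs_weight_integral:
  shows "integrable (lambda_prod (ball (Suc n))) (gibbs_weight V L x0 \<beta> H h (Suc n))"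
    and "gibbs_Z V L x0 \<beta> H h (Suc n) = Z"
proof -
  have nn: "(\<integral>\<^sup>+\<sigma>. ennreal (gibbs_weight V L x0 \<beta> H h (Suc n) \<sigma>) \<partial>lambda_prod (ball (Suc n))) = ennreal Z"
    unfolding nn_integral_weight[of n, symmetric]
    by (rule nn_integral_cong) (simp only: space_lambda_prod gibbs_weight_eq)
  have nonneg: "AE \<sigma> in lambda_prod (ball (Suc n)). 0 \<le> gibbs_weight V L x0 \<beta> H h (Suc n) \<sigma>"
    by (simp add: gibbs_weight_def)
  show "integrable (lambda_prod (ball (Suc n))) (gibbs_weight V L x0 \<beta> H h (Suc n))"
    using gibbs_weight_measurable nonneg nn by (rule integrableI_nn_integral_finite)
  show "gibbs_Z V L x0 \<beta> H h (Suc n) = Z"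
    unfolding gibbs_Z_def integral_eq_nn_integral[OF gibbs_weight_measurable nonneg] nn
    using root_integral(2) by simp
qed

lemma gibbs_density_eq:
  "\<sigma> \<in> ball (Suc n) \<rightarrow>\<^sub>E {0..1} \<Longrightarrow> gibbs_density V L x0 \<beta> H h (Suc n) \<sigma> = inverse Z * weight (Suc n) \<sigma>"
  by (simp only: gibbs_density_def gibbs_weight_integral gibbs_weight_eq)

text \<open>Compatibility is demanded for every inner configuration and not just almost every one,
  so the integral is evaluated at a fixed \<open>\<sigma>\<close> instead of being read off from the
  marginals.\<close>

lemma compatible: "compatible_densities V L x0 \<beta> H h"
  unfolding compatible_densities_def
proof (intro conjI allI ballI impI)
  fix n :: nat assume "1 \<le> n"
  then show "integrable (lambda_prod (ball n)) (gibbs_weight V L x0 \<beta> H h n)"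
    using gibbs_weight_integral(1)[of "n - 1"] by simp
next
  fix n :: nat and \<sigma> :: "'v \<Rightarrow> real"
  assume "2 \<le> n" and \<sigma>: "\<sigma> \<in> ball (n - 1) \<rightarrow>\<^sub>E {0..1}"
  then obtain m where n: "n = Suc (Suc m)"
    by (metis add_2_eq_Suc le_Suc_ex)
  let ?m = "merge (ball (Suc m)) (sphere (Suc (Suc m)))"
  from \<sigma> n have \<sigma>': "\<sigma> \<in> ball (Suc m) \<rightarrow>\<^sub>E {0..1}"
    by simp
  have in_cube: "?m (\<sigma>, \<omega>) \<in> ball (Suc (Suc m)) \<rightarrow>\<^sub>E {0..1}" if "\<omega> \<in> space (lambda_prod (sphere (Suc (Suc m))))" for \<omega>
    using that \<sigma>' ball_sphere_disjoint[of "Suc m"] unfolding space_lambda_prod ball_Suc[of "Suc m"]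
    by (simp add: PiE_def)
  have "(LINT \<omega>|lambda_prod (sphere (Suc (Suc m))). gibbs_density V L x0 \<beta> H h (Suc (Suc m)) (?m (\<sigma>, \<omega>)))
      = (LINT \<omega>|lambda_prod (sphere (Suc (Suc m))). inverse Z * weight (Suc (Suc m)) (?m (\<sigma>, \<omega>)))"
    by (intro Bochner_Integration.integral_cong refl gibbs_density_eq in_cube)
  also have "\<dots> = inverse Z * (LINT \<omega>|lambda_prod (sphere (Suc (Suc m))). weight (Suc (Suc m)) (?m (\<sigma>, \<omega>)))"
    by (rule integral_mult_right_zero)
  also have "(LINT \<omega>|lambda_prod (sphere (Suc (Suc m))). weight (Suc (Suc m)) (?m (\<sigma>, \<omega>)))
      = enn2real (ennreal (integrated_weight (Suc m) \<sigma>))"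
    unfolding nn_integral_weight_merge[OF \<sigma>', symmetric]
    by (intro integral_eq_nn_integral weight_merge_measurable[OF \<sigma>'] AE_I2 less_imp_le[OF weight_pos] in_cube)
  also have "enn2real (ennreal (integrated_weight (Suc m) \<sigma>)) = weight (Suc m) \<sigma>"
    using weight_pos[OF \<sigma>'] by (simp add: integrated_weight_eq_weight[OF \<sigma>'])
  also have "inverse Z * weight (Suc m) \<sigma> = gibbs_density V L x0 \<beta> H h (Suc m) \<sigma>"
    by (rule gibbs_density_eq[OF \<sigma>', symmetric])
  finally show "(LINT \<omega>|lambda_prod (sphere n). gibbs_density V L x0 \<beta> H h n (merge (ball (n - 1)) (sphere n) (\<sigma>, \<omega>)))
      = gibbs_density V L x0 \<beta> H h (n - 1) \<sigma>"
    by (simp only: n diff_Suc_1)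
qed

lemma exists_splitting_gibbs_measure:
  "\<exists>\<mu>. splitting_gibbs_measure V L x0 \<beta> H h \<mu> \<and>
    distr \<mu> unit_lebesgue (\<lambda>\<sigma>. \<sigma> x0) = density unit_lebesgue (\<lambda>t. ennreal (inverse Z * root k (\<phi> x0 t) ^ (k + 1)))"
proof -
  have exhaust: "\<exists>n. J \<subseteq> ball (Suc n)" if J: "finite J" "J \<subseteq> V" for J
  proof -
    obtain n where "J \<subseteq> ball n"
      using finite_subset_ball[OF J] by blast
    then have "J \<subseteq> ball (Suc n)"
      by (auto simp: ball_Suc)
    then show ?thesis ..
  qed
  have incr: "ball (Suc n) \<subseteq> ball (Suc (Suc n))" for n
    by (rule ball_mono) simp
  \<comment> \<open>The chain starts with the ball of radius 1, as level 0 does not belong to the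
    consistent family.\<close>
  obtain \<mu> where \<mu>: "prob_space \<mu>" "sets \<mu> = sets (PiM V (\<lambda>_. unit_lebesgue))"
    and marg: "\<And>n. distr \<mu> (lambda_prod (ball (Suc n))) (\<lambda>\<sigma>. restrict \<sigma> (ball (Suc n))) = level_measure (Suc n)"
    using exists_measure_with_marginals[of "\<lambda>n. ball (Suc n)" V "\<lambda>n. level_measure (Suc n)",
      OF finite_ball ball_subset incr exhaust prob_space_level_measure sets_level_measure distr_level_measure]
    by metis
  have "splitting_gibbs_measure V L x0 \<beta> H h \<mu>"
    unfolding splitting_gibbs_measure_def
  proof (intro conjI allI impI compatible \<mu>)
    fix n :: nat assume "1 \<le> n"
    then obtain m where n: "n = Suc m"
      by (cases n) auto
    have w: "(\<lambda>\<sigma>. ennreal (inverse Z * weight (Suc m) \<sigma>)) \<in> borel_measurable (lambda_prod (ball (Suc m)))"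
      by (intro measurable_compose[OF _ measurable_ennreal] borel_measurable_times weight_measurable borel_measurable_const)
    have g: "(\<lambda>\<sigma>. ennreal (gibbs_density V L x0 \<beta> H h (Suc m) \<sigma>)) \<in> borel_measurable (lambda_prod (ball (Suc m)))"
      unfolding gibbs_density_def
      by (intro measurable_compose[OF _ measurable_ennreal] borel_measurable_times gibbs_weight_measurable borel_measurable_const)
    have "level_measure (Suc m) = density (lambda_prod (ball (Suc m))) (\<lambda>\<sigma>. ennreal (gibbs_density V L x0 \<beta> H h (Suc m) \<sigma>))"
      unfolding level_measure_def
      by (rule density_cong[OF w g]) (intro AE_I2, simp only: space_lambda_prod gibbs_density_eq)
    then show "distr \<mu> (lambda_prod (ball n)) (\<lambda>\<sigma>. restrict \<sigma> (ball n))
        = density (lambda_prod (ball n)) (\<lambda>\<sigma>. ennreal (gibbs_density V L x0 \<beta> H h n \<sigma>))"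
      by (simp only: n marg)
  qed
  moreover have "distr \<mu> unit_lebesgue (\<lambda>\<sigma>. \<sigma> x0)
      = density unit_lebesgue (\<lambda>t. ennreal (inverse Z * root k (\<phi> x0 t) ^ (k + 1)))"
  proof -
    have x0: "x0 \<in> ball (Suc 0)"
      using root by (simp add: ball_V_def)
    have restr: "(\<lambda>\<sigma>. restrict \<sigma> (ball (Suc 0))) \<in> measurable \<mu> (lambda_prod (ball (Suc 0)))"
      unfolding measurable_cong_sets[OF \<mu>(2) refl] lambda_prod_def
      by (rule measurable_restrict_subset[OF ball_subset])
    have "distr (distr \<mu> (lambda_prod (ball (Suc 0))) (\<lambda>\<sigma>. restrict \<sigma> (ball (Suc 0)))) unit_lebesgue (\<lambda>\<sigma>. \<sigma> x0)
        = distr \<mu> unit_lebesgue ((\<lambda>\<sigma>. \<sigma> x0) \<circ> (\<lambda>\<sigma>. restrict \<sigma> (ball (Suc 0))))"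
      by (rule distr_distr[OF measurable_lambda_prod_component[OF x0] restr])
    also have "(\<lambda>\<sigma>. \<sigma> x0) \<circ> (\<lambda>\<sigma>. restrict \<sigma> (ball (Suc 0))) = (\<lambda>\<sigma> :: 'v \<Rightarrow> real. \<sigma> x0)"
      using x0 by (simp add: fun_eq_iff)
    finally show ?thesis
      by (simp only: marg distr_level_measure_root)
  qed
  ultimately show ?thesis
    by blast
qed

end

end

section \<open>Interchanged profiles\<close>

text \<open>Two continuous functions that differ at an interior point differ on a small interval
  inside (0,1), which has positive measure.\<close>

lemma continuous_AE_unit_lebesgue_eq:
  fixes F G :: "real \<Rightarrow> real"
  assumes F: "continuous_on UNIV F" and G: "continuous_on UNIV G"
    and eq: "AE t in unit_lebesgue. F t = G t" and t: "t \<in> {0<..<1}"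
  shows "F t = G t"
proof (rule ccontr)
  assume "F t \<noteq> G t"
  define S where "S = {s. F s \<noteq> G s} \<inter> {0<..<1}"
  have "open S"
    unfolding S_def by (intro open_Int open_Collect_neq F G open_greaterThanLessThan)
  moreover have "t \<in> S"
    using t \<open>F t \<noteq> G t\<close> by (simp add: S_def)
  ultimately obtain e where e: "0 < e" "ball t e \<subseteq> S"
    using open_contains_ball by blast
  have "AE s in lborel. s \<in> {0..1} \<longrightarrow> F s = G s"
    using eq unfolding unit_lebesgue_def by (subst (asm) AE_restrict_space_iff) simp_all
  then have "AE s in lborel. s \<notin> ball t e"
  proof (rule eventually_mono)
    fix s assume *: "s \<in> {0..1} \<longrightarrow> F s = G s"
    show "s \<notin> ball t e"
    proof
      assume "s \<in> ball t e"
      then have "s \<in> S"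
        using e(2) by blast
      with * show False
        by (simp add: S_def)
    qed
  qed
  then have "ball t e \<in> null_sets lborel"
    by (subst AE_iff_null_sets) simp_all
  then show False
    using e(1) by (simp add: null_sets_def ball_eq_greaterThanLessThan)
qed

text \<open>Equal measures have almost everywhere equal densities, hence equal ones on (0,1) by
  continuity. Comparing two points and cross-multiplying eliminates the unknown constants
  \<open>c\<close> and \<open>c'\<close>; taking roots then undoes the exponent.\<close>

lemma root_density_proportional:
  fixes f f' :: "real \<Rightarrow> real"
  assumes eq: "density unit_lebesgue (\<lambda>t. ennreal (c * root k (f t) ^ (k + 1)))
      = density unit_lebesgue (\<lambda>t. ennreal (c' * root k (f' t) ^ (k + 1)))"
    and c: "0 < c" "0 < c'" and k: "0 < k"
    and cont: "continuous_on UNIV f" "continuous_on UNIV f'"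
    and pos: "\<And>t. t \<in> {0..1} \<Longrightarrow> 0 < f t" "\<And>t. t \<in> {0..1} \<Longrightarrow> 0 < f' t"
    and st: "s \<in> {0<..<1}" "t \<in> {0<..<1}"
  shows "f s * f' t = f t * f' s"
proof -
  let ?F = "\<lambda>t. c * root k (f t) ^ (k + 1)" and ?G = "\<lambda>t. c' * root k (f' t) ^ (k + 1)"
  have F: "continuous_on UNIV ?F" and G: "continuous_on UNIV ?G"
    by (intro continuous_on_mult continuous_on_const continuous_on_power continuous_on_real_root cont)+
  have meas: "(\<lambda>t. ennreal (?F t)) \<in> borel_measurable unit_lebesgue" "(\<lambda>t. ennreal (?G t)) \<in> borel_measurable unit_lebesgue"
    by (intro measurable_compose[OF _ measurable_ennreal] measurable_unit_lebesgue borel_measurable_continuous_onI F G)+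
  have nonneg: "0 \<le> ?F t" "0 \<le> ?G t" if "t \<in> {0..1}" for t
    using c pos[OF that] k by (simp_all add: less_imp_le)
  have "sigma_finite_measure unit_lebesgue"
    by (rule prob_space_imp_sigma_finite[OF prob_space_unit_lebesgue])
  then have ae: "AE t in unit_lebesgue. ennreal (?F t) = ennreal (?G t)"
    using sigma_finite_measure.density_unique_iff[OF _ meas] eq by blast
  have "AE t in unit_lebesgue. ?F t = ?G t"
    using ae AE_space
  proof eventually_elim
    case (elim t)
    then show ?case
      using nonneg[of t] by (simp only: space_unit_lebesgue ennreal_inj)
  qed
  then have *: "?F t = ?G t" if "t \<in> {0<..<1}" for t
    using that by (rule continuous_AE_unit_lebesgue_eq[OF F G])
  define a b where "a = root k (f s) * root k (f' t)" and "b = root k (f t) * root k (f' s)"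
  have "(c * c') * a ^ (k + 1) = ?F s * ?G t"
    by (simp only: a_def power_mult_distrib mult_ac)
  also have "\<dots> = ?F t * ?G s"
    by (simp only: *[OF st(1)] *[OF st(2)] mult.commute)
  also have "\<dots> = (c * c') * b ^ (k + 1)"
    by (simp only: b_def power_mult_distrib mult_ac)
  finally have "a ^ (k + 1) = b ^ (k + 1)"
    using c by simp
  moreover have "0 \<le> a" "0 \<le> b"
    using pos[of s] pos[of t] st k by (simp_all add: a_def b_def less_imp_le)
  ultimately have "a = b"
    using power_eq_iff_eq_base[of "k + 1" a b] by simp
  then have "root k (f s * f' t) = root k (f t * f' s)"
    by (simp only: a_def b_def real_root_mult)
  then show ?thesis
    using k by (simp only: real_root_eq_iff)
qed

definition interchanged :: "nat \<Rightarrow> (real \<Rightarrow> real) \<Rightarrow> (real \<Rightarrow> real) \<Rightarrow> bool" where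
  "interchanged k f g \<longleftrightarrow>
    (\<forall>s. ((\<lambda>t. K_tilde (s - 1/2) (t - 1/2) k * g t) has_integral root k (f s)) {0..1}) \<and>
    (\<forall>s. ((\<lambda>t. K_tilde (s - 1/2) (t - 1/2) k * f t) has_integral root k (g s)) {0..1})"

lemma interchanged_commute: "interchanged k f g \<longleftrightarrow> interchanged k g f"
  by (auto simp: interchanged_def)

text \<open>Periodicity only sees field differences from t = 0, so the two profiles must differ
  after division by their values at 0. The root is even, which is why its law involves
  \<open>f\<close>.\<close>

lemma interchanged_periodic_gibbs_measure:
  fixes V :: "'v set"
  assumes tree: "cayley_tree k V L" "x0 \<in> V" and k: "0 < k" and \<beta>: "0 < \<beta>"
    and K_pos: "\<And>s t. s \<in> {0..1} \<Longrightarrow> t \<in> {0..1} \<Longrightarrow> 0 < K_tilde (s - 1/2) (t - 1/2) k"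
    and fg: "interchanged k f g"
    and cont: "continuous_on UNIV f" "continuous_on UNIV g"
    and pos: "\<And>t. t \<in> {0..1} \<Longrightarrow> 0 < f t" "\<And>t. t \<in> {0..1} \<Longrightarrow> 0 < g t"
    and neq: "t0 \<in> {0..1}" "f t0 / f 0 \<noteq> g t0 / g 0"
  shows "\<exists>\<mu>. periodic_gibbs_measure V L x0 \<beta> (K_tilde_hamiltonian L x0 \<beta> k) \<mu> \<and>
    (\<exists>c>0. distr \<mu> unit_lebesgue (\<lambda>\<sigma>. \<sigma> x0) = density unit_lebesgue (\<lambda>t. ennreal (c * root k (f t) ^ (k + 1))))"
proof -
  define \<phi> where "\<phi> x = (if even (graph_dist L x x0) then f else g)" for x :: 'v
  let ?K = "\<lambda>s t. K_tilde (s - 1/2) (t - 1/2) k"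
  have \<phi>_cont: "continuous_on UNIV (\<phi> x)" for x
    using cont by (simp add: \<phi>_def)
  have \<phi>_pos: "0 < \<phi> x t" if "t \<in> {0..1}" for x t
    using pos[OF that] by (simp add: \<phi>_def)
  have meas_section: "(\<lambda>t. ?K s t * \<phi> y t) \<in> borel_measurable borel" for s y
  proof -
    have "continuous_on UNIV (\<lambda>t. ?K s t)"
      using continuous_on_compose2[OF continuous_on_K_tilde[of k], of UNIV "\<lambda>t. (s, t)"]
      by (simp add: continuous_on_Pair continuous_on_const continuous_on_id)
    then show ?thesis
      by (intro borel_measurable_continuous_onI continuous_on_mult \<phi>_cont)
  qed
  interpret tree_kernel k V L x0 ?K \<phi>
  proof (rule tree_kernel.intro, rule rooted_cayley_tree.intro[OF tree], rule tree_kernel_axioms.intro)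
    fix x y s assume xy: "direct_successor L x0 x y" and s: "s \<in> {0..1::real}"
    \<comment> \<open>Parity alternates along an edge, so the two endpoints carry \<open>f\<close>
      and \<open>g\<close> in one order or the other; each order is one half of
      \<open>interchanged\<close>.\<close>
    have "((\<lambda>t. ?K s t * \<phi> y t) has_integral root k (\<phi> x s)) {0..1}"
      using xy fg by (simp add: \<phi>_def interchanged_def direct_successor_def)
    then show "(\<integral>\<^sup>+t. ennreal (?K s t * \<phi> y t) \<partial>unit_lebesgue) = ennreal (root k (\<phi> x s))"
      by (rule nn_integral_unit_lebesgue[OF meas_section])
        (intro mult_nonneg_nonneg less_imp_le[OF K_pos] less_imp_le[OF \<phi>_pos] s)
  qed (use k continuous_on_K_tilde K_pos \<phi>_cont \<phi>_pos in auto)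
  define h where "h x t = ln (\<phi> x t)" for x t
  let ?H = "K_tilde_hamiltonian L x0 \<beta> k"
  have H: "exp (- \<beta> * ?H (ball_V V L x0 n) \<sigma>) = interaction n \<sigma>" if \<sigma>: "\<sigma> \<in> ball_V V L x0 n \<rightarrow>\<^sub>E {0..1}" for n \<sigma>
  proof -
    have "- \<beta> * ?H (ball_V V L x0 n) \<sigma> = (\<Sum>(x, y)\<in>edges_up_to n. ln (?K (\<sigma> x) (\<sigma> y)))"
      using \<beta> by (simp add: K_tilde_hamiltonian_def edges_up_to_def)
    also have "exp \<dots> = (\<Prod>(x, y)\<in>edges_up_to n. exp (ln (?K (\<sigma> x) (\<sigma> y))))"
      by (simp only: exp_sum[OF finite_edges_up_to] case_prod_unfold)
    also have "\<dots> = interaction n \<sigma>"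
      unfolding interaction_def
    proof (rule prod.cong[OF refl], clarify)
      fix x y assume "(x, y) \<in> edges_up_to n"
      then have "\<sigma> x \<in> {0..1}" "\<sigma> y \<in> {0..1}"
        using PiE_mem[OF \<sigma>] by (simp_all only: edges_up_to_def mem_Collect_eq prod.case)
      then show "exp (ln (?K (\<sigma> x) (\<sigma> y))) = ?K (\<sigma> x) (\<sigma> y)"
        by (simp only: exp_ln K_pos)
    qed
    finally show ?thesis .
  qed
  obtain \<mu> where \<mu>: "splitting_gibbs_measure V L x0 \<beta> ?H h \<mu>"
    and law: "distr \<mu> unit_lebesgue (\<lambda>\<sigma>. \<sigma> x0) = density unit_lebesgue (\<lambda>t. ennreal (inverse Z * root k (\<phi> x0 t) ^ (k + 1)))"
    using exists_splitting_gibbs_measure[of \<beta> ?H h, OF H] by (metis h_def)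
  have h_diff: "exp (h x t - h x 0) = \<phi> x t / \<phi> x 0" if "t \<in> {0..1}" for x t
    using \<phi>_pos[OF that, of x] \<phi>_pos[of 0 x] by (simp add: h_def exp_diff)
  have "periodic_gibbs_measure V L x0 \<beta> ?H \<mu>"
    unfolding periodic_gibbs_measure_def
  proof (rule exI[of _ h], rule exI[of _ "\<lambda>t. f t / f 0"], rule exI[of _ "\<lambda>t. g t / g 0"], intro conjI)
    have fg0: "0 < f 0" "0 < g 0"
      using pos[of 0] by simp_all
    show "continuous_on {0..1} (\<lambda>t. f t / f 0)" "continuous_on {0..1} (\<lambda>t. g t / g 0)"
      by (intro continuous_on_divide continuous_on_const continuous_on_subset[OF cont(1)]
          continuous_on_subset[OF cont(2)]; use fg0 in simp)+
    show "\<forall>t\<in>{0..1}. f t / f 0 > 0" "\<forall>t\<in>{0..1}. g t / g 0 > 0"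
      by (intro ballI divide_pos_pos pos fg0; assumption)+
  qed (use \<mu> neq in \<open>auto simp: h_diff \<phi>_def\<close>)
  moreover have "\<phi> x0 = f"
    by (simp add: \<phi>_def)
  then have "distr \<mu> unit_lebesgue (\<lambda>\<sigma>. \<sigma> x0) = density unit_lebesgue (\<lambda>t. ennreal (inverse Z * root k (f t) ^ (k + 1)))"
    using law by (simp only:)
  moreover have "0 < inverse Z"
    using root_integral(2) by simp
  ultimately show ?thesis
    by (intro exI[of _ \<mu>] conjI exI[of _ "inverse Z"])
qed

text \<open>Indexing by 0, ..., 3 lets the four measures be chosen as one family whose injectivity
  gives the count.\<close>

definition profile :: "nat \<Rightarrow> real \<Rightarrow> real" where
  "profile i t = ([quintic (3/4) 0 0 20 0, quintic (1/2) 6 0 0 0, quintic 1 0 1 0 0, quintic 1 0 0 0 1] ! i) (t - 1/2)"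

lemma profile_simps:
  "profile 0 t = 20 * (t - 1/2) ^ 4 + 3/4"
  "profile (Suc 0) t = 6 * (t - 1/2) ^ 2 + 1/2"
  "profile 2 t = (t - 1/2) ^ 3 + 1"
  "profile 3 t = (t - 1/2) ^ 5 + 1"
  by (simp_all add: profile_def quintic_def numeral_2_eq_2 numeral_3_eq_3)

text \<open>Even profiles are exchanged because 3/4 + 20/80 = 1/2 + 6/12 = 1 and 20/20 = 6/6 = 1;
  for the odd ones the mean is 1 and the leading coefficient is 1.\<close>

lemma interchanged_profiles:
  "interchanged k (profile 0) (profile 1)" "interchanged k (profile 2) (profile 3)"
proof -
  note * = has_integral_K_tilde_quintic
  show "interchanged k (profile 0) (profile 1)"
    using *[of "s - 1/2" k "3/4" 0 0 20 0 for s] *[of "s - 1/2" k "1/2" 6 0 0 0 for s]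
    by (simp add: interchanged_def profile_def quintic_def add.commute)
  show "interchanged k (profile 2) (profile 3)"
    using *[of "s - 1/2" k 1 0 1 0 0 for s] *[of "s - 1/2" k 1 0 0 0 1 for s]
    by (simp add: interchanged_def profile_def quintic_def add.commute)
qed

lemma continuous_on_profile:
  assumes "i < 4"
  shows "continuous_on UNIV (profile i)"
proof -
  have *: "continuous_on UNIV (\<lambda>t. quintic a b c d e (t - 1/2))" for a b c d e
    unfolding quintic_def by (intro continuous_intros)
  have "i \<in> {0, 1, 2, 3}"
    using assms by auto
  then show ?thesis
    unfolding profile_def [abs_def] by (auto simp: * numeral_2_eq_2 numeral_3_eq_3)
qed

lemma profile_pos:
  assumes "i < 4" "t \<in> {0..1}"
  shows "0 < profile i t"
proof -
  have "\<bar>t - 1/2\<bar> \<le> 1/2"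
    using assms(2) unfolding atLeastAtMost_iff by linarith
  from radicands_bounded[OF this] have "1/2 \<le> profile 0 t" "1/2 \<le> profile 1 t" "1/2 \<le> profile 2 t" "1/2 \<le> profile 3 t"
    by (simp_all only: profile_simps atLeastAtMost_iff One_nat_def)
  moreover have "i \<in> {0, 1, 2, 3}"
    using assms(1) by auto
  ultimately show ?thesis
    by auto
qed

lemma profile_half: "profile 0 (1/2) = 3/4" "profile 1 (1/2) = 1/2" "profile 2 (1/2) = 1" "profile 3 (1/2) = 1"
  by (simp_all add: profile_simps)

lemma profile_quarter:
  "profile 0 (1/4) = 53/64" "profile 1 (1/4) = 7/8" "profile 2 (1/4) = 63/64" "profile 3 (1/4) = 1023/1024"
  by (simp_all add: profile_simps power_divide)

lemma profile_at_0: "profile 0 0 = 2" "profile 1 0 = 2" "profile 2 0 = 7/8" "profile 3 0 = 31/32"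
  by (simp_all add: profile_simps power_divide)

text \<open>The quotients of the values at 1/4 and 1/2 are 53/48, 7/4, 63/64 and 1023/1024, pairwise
  distinct. Both points are interior, as the comparison of densities requires.\<close>

lemma profile_proportional_imp_eq:
  assumes "i < 4" "j < 4" "profile i (1/2) * profile j (1/4) = profile i (1/4) * profile j (1/2)"
  shows "i = j"
proof -
  have "i \<in> {0, 1, 2, 3}" "j \<in> {0, 1, 2, 3}"
    using assms by auto
  then show ?thesis
    using assms(3) by (auto simp: profile_half[unfolded One_nat_def] profile_quarter[unfolded One_nat_def])
qed

text \<open>Normalised at 0, the values at 1/2 are 3/8 against 1/4 for the even pair and 8/7 against
  32/31 for the odd pair.\<close>

lemma profile_has_partner:
  assumes "i < 4"
  shows "\<exists>j<4. interchanged k (profile i) (profile j) \<and> profile i (1/2) / profile i 0 \<noteq> profile j (1/2) / profile j 0"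
proof -
  have "i \<in> {0, 1, 2, 3}"
    using assms by auto
  then consider "i = 0" | "i = 1" | "i = 2" | "i = 3"
    by blast
  then show ?thesis
  proof cases
    case 1
    then show ?thesis
      by (intro exI[of _ 1]) (simp add: interchanged_profiles(1)[unfolded One_nat_def]
        profile_half[unfolded One_nat_def] profile_at_0[unfolded One_nat_def])
  next
    case 2
    then show ?thesis
      by (intro exI[of _ 0]) (simp add: interchanged_profiles(1)[unfolded One_nat_def]
        interchanged_commute[of k "profile (Suc 0)"] profile_half[unfolded One_nat_def] profile_at_0[unfolded One_nat_def])
  next
    case 3
    then show ?thesis
      by (intro exI[of _ 3]) (simp add: interchanged_profiles(2) profile_half profile_at_0)
  next
    case 4
    then show ?thesis
      by (intro exI[of _ 2]) (simp add: interchanged_profiles(2) interchanged_commute[of k "profile 3"]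
        profile_half profile_at_0)
  qed
qed

lemma four_periodic_gibbs_measures:
  fixes V :: "'v set"
  assumes tree: "cayley_tree k V L" "x0 \<in> V" and k: "0 < k" and \<beta>: "0 < \<beta>"
    and K_pos: "\<And>s t. s \<in> {0..1} \<Longrightarrow> t \<in> {0..1} \<Longrightarrow> 0 < K_tilde (s - 1/2) (t - 1/2) k"
  shows "\<exists>M. card M = 4 \<and> (\<forall>\<mu>\<in>M. periodic_gibbs_measure V L x0 \<beta> (K_tilde_hamiltonian L x0 \<beta> k) \<mu>)"
proof -
  let ?root_law = "\<lambda>i \<mu>. \<exists>c>0. distr \<mu> unit_lebesgue (\<lambda>\<sigma>. \<sigma> x0)
    = density unit_lebesgue (\<lambda>t. ennreal (c * root k (profile i t) ^ (k + 1)))"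
  have "\<forall>i\<in>{..<4}. \<exists>\<mu>. periodic_gibbs_measure V L x0 \<beta> (K_tilde_hamiltonian L x0 \<beta> k) \<mu> \<and> ?root_law i \<mu>"
  proof
    fix i :: nat assume "i \<in> {..<4}"
    then have i: "i < 4"
      by simp
    obtain j where j: "j < 4" "interchanged k (profile i) (profile j)"
        "profile i (1/2) / profile i 0 \<noteq> profile j (1/2) / profile j 0"
      using profile_has_partner[OF i] by blast
    show "\<exists>\<mu>. periodic_gibbs_measure V L x0 \<beta> (K_tilde_hamiltonian L x0 \<beta> k) \<mu> \<and> ?root_law i \<mu>"
      by (rule interchanged_periodic_gibbs_measure[OF tree k \<beta> K_pos j(2) continuous_on_profile[OF i]
            continuous_on_profile[OF j(1)] profile_pos[OF i] profile_pos[OF j(1)] _ j(3)]) simp_all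
  qed
  from bchoice[OF this] obtain \<mu> where \<mu>: "\<And>i. i < 4 \<Longrightarrow> periodic_gibbs_measure V L x0 \<beta> (K_tilde_hamiltonian L x0 \<beta> k) (\<mu> i)"
    and law: "\<And>i. i < 4 \<Longrightarrow> ?root_law i (\<mu> i)"
    by (auto simp only: lessThan_iff)
  \<comment> \<open>Equal measures would have the same root law and thus proportional
    profiles.\<close>
  have "inj_on \<mu> {..<4}"
  proof (rule inj_onI)
    fix i j assume "i \<in> {..<4::nat}" "j \<in> {..<4::nat}" and eq: "\<mu> i = \<mu> j"
    then have ij: "i < 4" "j < 4"
      by simp_all
    obtain c where c: "0 < c" "distr (\<mu> i) unit_lebesgue (\<lambda>\<sigma>. \<sigma> x0)
        = density unit_lebesgue (\<lambda>t. ennreal (c * root k (profile i t) ^ (k + 1)))"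
      using law[OF ij(1)] by (elim exE conjE)
    obtain c' where c': "0 < c'" "distr (\<mu> j) unit_lebesgue (\<lambda>\<sigma>. \<sigma> x0)
        = density unit_lebesgue (\<lambda>t. ennreal (c' * root k (profile j t) ^ (k + 1)))"
      using law[OF ij(2)] by (elim exE conjE)
    have "profile i (1/2) * profile j (1/4) = profile i (1/4) * profile j (1/2)"
      by (rule root_density_proportional[OF trans[OF c(2)[symmetric, unfolded eq] c'(2)] c(1) c'(1) k
            continuous_on_profile[OF ij(1)] continuous_on_profile[OF ij(2)] profile_pos[OF ij(1)] profile_pos[OF ij(2)]])
        simp_all
    then show "i = j"
      by (rule profile_proportional_imp_eq[OF ij])
  qed
  then have "card (\<mu> ` {..<4}) = 4"
    by (simp add: card_image)
  then show ?thesis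
    using \<mu> by (intro exI[of _ "\<mu> ` {..<4}"]) auto
qed

theorem theorem9p5:
  shows "(\<exists>k0\<ge>2. K_tilde_positive_from k0) \<and>
    (\<forall>k0\<ge>2. K_tilde_positive_from k0 \<longrightarrow>
      (\<forall>\<beta>>0. \<forall>k\<ge>k0. \<forall>(V :: 'v set) L x0. cayley_tree k V L \<and> x0 \<in> V \<longrightarrow>
        (\<exists>M. card M = 4 \<and>
          (\<forall>\<mu>\<in>M. periodic_gibbs_measure V L x0 \<beta> (K_tilde_hamiltonian L x0 \<beta> k) \<mu>))))"
proof (intro conjI allI impI K_tilde_eventually_positive)
  fix k0 k :: nat and \<beta> :: real and V :: "'v set" and L x0
  assume k0: "2 \<le> k0" "K_tilde_positive_from k0" and \<beta>: "0 < \<beta>" and k: "k0 \<le> k"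
    and tree: "cayley_tree k V L \<and> x0 \<in> V"
  show "\<exists>M. card M = 4 \<and> (\<forall>\<mu>\<in>M. periodic_gibbs_measure V L x0 \<beta> (K_tilde_hamiltonian L x0 \<beta> k) \<mu>)"
  proof (rule four_periodic_gibbs_measures[OF _ _ _ \<beta>])
    show "0 < K_tilde (s - 1/2) (t - 1/2) k" if "s \<in> {0..1}" "t \<in> {0..1}" for s t
      using k0(2) k that unfolding K_tilde_positive_from_def by blast
  qed (use tree k0 k in auto)
qed

end
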